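(* Let $A\in\mathbb{R}^{m\times n}$ have rank $r$, let $b\in\mathbb{R}^m$, and let $M\in\mathbb{R}^{m\times m}$, $N\in\mathbb{R}^{n\times n}$ be symmetric positive definite with $M^{-1}=L_M^{\top}L_M$ and $N^{-1}=L_N^{\top}L_N$ (Cholesky factorizations). Let $U_A=(u_{A,1},\dots,u_{A,m})$, $D_A=\mathrm{diag}(\sigma_1,\dots,\sigma_r)$, $Z=(z_1,\dots,z_n)$ be given by the normalized GSVD of $\{L_MA,L_N\}$, with generalized singular values $\gamma_i=\sigma_i$, $1\le i\le r$, and let $U_{A,r}$ be the first $r$ columns of $U_A$. Assume that $u_{A,i}^{\top}L_Mb\neq 0$ for all $1\le i\le r$. Suppose $\{\gamma_i\}_{i=1}^{r}$ have distinct values. For any $1\le k\le r$, let $$D=\mathrm{diag}(D_AU_{A,r}^{\top}L_Mb)=\begin{pmatrix}D_1&\\&D_2\end{pmatrix},\qquad D_1\in\mathbb{R}^{k\times k},\ D_2\in\mathbb{R}^{(r-k)\times(r-k)},$$ $$H_k=\begin{pmatrix}1&\sigma_1^2&\cdots&\sigma_1^{2k-2}\\1&\sigma_2^2&\cdots&\sigma_2^{2k-2}\\\vdots&\vdots&\ddots&\vdots\\1&\sigma_r^2&\cdots&\sigma_r^{2k-2}\end{pmatrix}=\begin{pmatrix}H_{k1}\\H_{k2}\end{pmatrix},\qquad H_{k1}\in\mathbb{R}^{k\times k},\ H_{k2}\in\mathbb{R}^{(r-k)\times k},$$ and $$\Delta_k=D_2H_{k2}H_{k1}^{-1}D_1^{-1}\in\mathbb{R}^{(r-k)\times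 k}.$$ Then the distance between the $k$-th solution subspace $\mathcal{S}_k=\mathrm{span}\{V_k\}$, where $V_k=(v_1,\dots,v_k)$ is generated by the generalized Golub-Kahan bidiagonalization (gen-GKB) of $A$ with starting vector $b$, and $\mathcal{Z}_k=\mathrm{span}\{z_1,\dots,z_k\}$ is $$\mathrm{dist}(\mathcal{S}_k,\mathcal{Z}_k)=\frac{\|\Delta_k\|_2}{\left(1+\|\Delta_k\|_2^2\right)^{1/2}}.$$
   Context: $\mathrm{span}\{\cdot\}$ denotes the subspace spanned by the columns of a matrix or by a group of vectors; for a vector $w$, $\mathrm{diag}(w)$ is the diagonal matrix with diagonal $w$; $\|\cdot\|_2$ of a matrix is the spectral norm. For symmetric positive definite $B$, $\langle x,x'\rangle_B=x^{\top}Bx'$ and $\|x\|_B=(x^{\top}Bx)^{1/2}$. Normalized GSVD of $\{L_MA,L_N\}$: $L_MA=U_A\Sigma_AZ^{-1}$ and $L_N=U_LZ^{-1}$, where $U_A\in\mathbb{R}^{m\times m}$ and $U_L\in\mathbb{R}^{n\times n}$ are orthogonal, $Z\in\mathbb{R}^{n\times n}$ is invertible with $N^{-1}$-orthonormal columns ($Z^{\top}N^{-1}Z=I$), and $\Sigma_A=\begin{pmatrix}D_A&0\\0&0\end{pmatrix}\in\mathbb{R}^{m\times n}$ with $D_A=\mathrm{diag}(\sigma_1,\dots,\sigma_r)$, $\sigma_1\ge\cdots\ge\sigma_r>0$. Gen-GKB: with $A^{*}=NA^{\top}M^{-1}$, vectors $u_i\in\mathbb{R}^m$, $v_i\in\mathbb{R}^n$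 and scalars $\alpha_i,\beta_i\ge 0$ are generated by $$\beta_1u_1=b,\qquad \alpha_i v_i = A^{*}u_i-\beta_i v_{i-1},\qquad \beta_{i+1}u_{i+1}=Av_i-\alpha_i u_i\qquad (i=1,2,\dots),$$ with $v_0=0$, where $\alpha_i,\beta_i$ are the normalization constants such that $\|u_i\|_{M^{-1}}=\|v_i\|_{N^{-1}}=1$. Distance between subspaces: for two $k$-dimensional subspaces $\mathcal{F},\mathcal{G}$ of $(\mathbb{R}^n,\langle\cdot,\cdot\rangle_{N^{-1}})$, the maximum canonical angle is $$\Theta(\mathcal{F},\mathcal{G})=\max_{u\in\mathcal{F},\,u\ne 0}\ \min_{v\in\mathcal{G},\,v\neq 0}\arccos\frac{|\langle u,v\rangle_{N^{-1}}|}{\|u\|_{N^{-1}}\|v\|_{N^{-1}}},$$ and $\mathrm{dist}(\mathcal{F},\mathcal{G})=\sin\Theta(\mathcal{F},\mathcal{G})$. For $k=r$ the matrix $\Delta_k$ is empty and its norm is $0$. *)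

theory Defs
  imports Complex_Main
    "Jordan_Normal_Form.DL_Rank"
    "Jordan_Normal_Form.Gauss_Jordan_Elimination"
begin

text \<open>
  Dimensions vary inside the statement, so matrices and vectors are those of
  \<open>Jordan_Normal_Form.Matrix\<close>.  That library indexes entries from 0; scalar and vector
  families are indexed from 1 here, and the shift is made where the two meet.
\<close>

text \<open>Meaningful for invertible arguments only.\<close>

definition mat_inv :: "real Matrix.mat \<Rightarrow> real Matrix.mat" where
  "mat_inv A = the (mat_inverse A)"

definition sym_pos_def :: "nat \<Rightarrow> real Matrix.mat \<Rightarrow> bool" where
  "sym_pos_def n B \<longleftrightarrow> B \<in> carrier_mat n n \<and> transpose_mat B = B \<and>
     (\<forall>x \<in> carrier_vec n. x \<noteq> 0\<^sub>v n \<longrightarrow> 0 < scalar_prod x (B *\<^sub>v x))"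

text \<open>Cholesky factorization in the form \<open>B = L\<^sup>T L\<close>, with \<open>L\<close> upper triangular.\<close>

definition cholesky_factor :: "nat \<Rightarrow> real Matrix.mat \<Rightarrow> real Matrix.mat \<Rightarrow> bool" where
  "cholesky_factor n B L \<longleftrightarrow> L \<in> carrier_mat n n \<and> upper_triangular L \<and>
     (\<forall>i<n. 0 < L $$ (i,i)) \<and> B = transpose_mat L * L"

text \<open>The library's \<open>orthogonal_mat\<close> does not require the columns to have unit length.\<close>

definition orthonormal_mat :: "nat \<Rightarrow> real Matrix.mat \<Rightarrow> bool" where
  "orthonormal_mat n Q \<longleftrightarrow> Q \<in> carrier_mat n n \<and> transpose_mat Q * Q = 1\<^sub>m n"

definition first_cols :: "nat \<Rightarrow> real Matrix.mat \<Rightarrow> real Matrix.mat" where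
  "first_cols k A = mat_of_cols (dim_row A) (take k (Matrix.cols A))"

definition vec_diag :: "real Matrix.vec \<Rightarrow> real Matrix.mat" where
  "vec_diag w = mat_diag (dim_vec w) (vec_index w)"

definition inner_wrt :: "real Matrix.mat \<Rightarrow> real Matrix.vec \<Rightarrow> real Matrix.vec \<Rightarrow> real" where
  "inner_wrt B x y = scalar_prod x (B *\<^sub>v y)"

definition norm_wrt :: "real Matrix.mat \<Rightarrow> real Matrix.vec \<Rightarrow> real" where
  "norm_wrt B x = sqrt (inner_wrt B x x)"

text \<open>The operator norm induced by the Euclidean norms.  The unit ball contains the zero
  vector, so a matrix without rows has norm 0.\<close>

definition spectral_norm :: "real Matrix.mat \<Rightarrow> real" where
  "spectral_norm A =
     (SUP x \<in> {x \<in> carrier_vec (dim_col A). scalar_prod x x \<le> 1}.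
        sqrt (scalar_prod (A *\<^sub>v x) (A *\<^sub>v x)))"

text \<open>The supremum and the infimum are attained for nonzero finite-dimensional subspaces
  and positive definite \<open>B\<close>, hence are the maximum and the minimum.\<close>

definition max_canonical_angle ::
  "real Matrix.mat \<Rightarrow> real Matrix.vec set \<Rightarrow> real Matrix.vec set \<Rightarrow> real" where
  "max_canonical_angle B F G =
     (SUP u \<in> F - {0\<^sub>v (dim_row B)}. INF v \<in> G - {0\<^sub>v (dim_row B)}.
        arccos (\<bar>inner_wrt B u v\<bar> / (norm_wrt B u * norm_wrt B v)))"

definition subspace_dist ::
  "real Matrix.mat \<Rightarrow> real Matrix.vec set \<Rightarrow> real Matrix.vec set \<Rightarrow> real" where
  "subspace_dist B F G = sin (max_canonical_angle B F G)"

text \<open>Normalized GSVD of \<open>{LA, LN}\<close>, where \<open>LA\<close> is the \<open>m \<times> n\<close> matrix \<open>L\<^sub>M A\<close> and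
  \<open>DA = diag (\<sigma> 1, \<dots>, \<sigma> r)\<close>.\<close>

definition normalized_gsvd ::
  "nat \<Rightarrow> nat \<Rightarrow> nat \<Rightarrow> real Matrix.mat \<Rightarrow> real Matrix.mat \<Rightarrow> real Matrix.mat \<Rightarrow>
   real Matrix.mat \<Rightarrow> real Matrix.mat \<Rightarrow> (nat \<Rightarrow> real) \<Rightarrow> real Matrix.mat \<Rightarrow> real Matrix.mat \<Rightarrow> bool"
where
  "normalized_gsvd m n r LA LN N UA UL \<sigma> DA Z \<longleftrightarrow>
     r \<le> m \<and> r \<le> n \<and>
     orthonormal_mat m UA \<and> orthonormal_mat n UL \<and>
     Z \<in> carrier_mat n n \<and> invertible_mat Z \<and>
     transpose_mat Z * mat_inv N * Z = 1\<^sub>m n \<and>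
     DA = mat_diag r (\<lambda>i. \<sigma> (Suc i)) \<and>
     (\<forall>i \<in> {1..r}. 0 < \<sigma> i) \<and>
     (\<forall>i \<in> {1..r}. \<forall>j \<in> {1..r}. i \<le> j \<longrightarrow> \<sigma> j \<le> \<sigma> i) \<and>
     LA = UA * four_block_mat DA (0\<^sub>m r (n - r)) (0\<^sub>m (m - r) r) (0\<^sub>m (m - r) (n - r)) * mat_inv Z \<and>
     LN = UL * mat_inv Z"

text \<open>\<open>u i\<close>, \<open>v i\<close>, \<open>\<alpha> i\<close>, \<open>\<beta> i\<close> for \<open>1 \<le> i \<le> k\<close> are generated by \<open>k\<close> steps of gen-GKB.
  Absence of breakdown is not assumed: if a right-hand side vanishes, the corresponding
  scalar is 0 and the unit vector next to it is arbitrary.\<close>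

definition gen_gkb ::
  "nat \<Rightarrow> real Matrix.mat \<Rightarrow> real Matrix.vec \<Rightarrow> real Matrix.mat \<Rightarrow> real Matrix.mat \<Rightarrow>
   (nat \<Rightarrow> real Matrix.vec) \<Rightarrow> (nat \<Rightarrow> real Matrix.vec) \<Rightarrow> (nat \<Rightarrow> real) \<Rightarrow> (nat \<Rightarrow> real) \<Rightarrow> bool"
where
  "gen_gkb k A b M N u v \<alpha> \<beta> \<longleftrightarrow>
     (\<forall>i \<in> {1..k}. u i \<in> carrier_vec (dim_row A) \<and> v i \<in> carrier_vec (dim_col A) \<and>
        0 \<le> \<alpha> i \<and> 0 \<le> \<beta> i \<and>
        norm_wrt (mat_inv M) (u i) = 1 \<and> norm_wrt (mat_inv N) (v i) = 1) \<and>
     v 0 = 0\<^sub>v (dim_col A) \<and>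
     \<beta> 1 \<cdot>\<^sub>v u 1 = b \<and>
     (\<forall>i \<in> {1..k}. \<alpha> i \<cdot>\<^sub>v v i =
        (N * transpose_mat A * mat_inv M) *\<^sub>v u i - \<beta> i \<cdot>\<^sub>v v (i - 1)) \<and>
     (\<forall>i \<in> {1..<k}. \<beta> (i + 1) \<cdot>\<^sub>v u (i + 1) = A *\<^sub>v v i - \<alpha> i \<cdot>\<^sub>v u i)"

end

theory Submission
  imports Defs "HOL-Analysis.Convex"
begin

text \<open>
  Write vectors in coordinates with respect to the columns of \<open>Z\<close>.  These columns are
  \<open>N\<^sup>-\<^sup>1\<close>-orthonormal, so the geometry becomes Euclidean (\<open>inner_wrt_coordinates\<close>), and the GSVD
  makes the operator \<open>A\<^sup>* A\<close> diagonal with entries \<open>\<sigma>\<^sub>1\<^sup>2, \<dots>, \<sigma>\<^sub>r\<^sup>2, 0, \<dots>, 0\<close>, while \<open>A\<^sup>* b\<close> has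
  the coordinates \<open>w\<^sub>i = \<sigma>\<^sub>i u\<^sub>A\<^sub>,\<^sub>i\<^sup>T L\<^sub>M b\<close>, all nonzero for \<open>i \<le> r\<close>, and zero afterwards
  (\<open>gsvd_adjoint\<close>, \<open>gsvd_normal_operator\<close>).
  
  Eliminating the vectors \<open>u\<^sub>i\<close> from gen-GKB leaves a three-term recurrence for the \<open>v\<^sub>i\<close>
  (\<open>gen_gkb_three_term\<close>).  Hence \<open>v\<^sub>i\<close> corresponds to a polynomial of degree exactly \<open>i - 1\<close> in
  \<open>A\<^sup>* A\<close> applied to \<open>A\<^sup>* b\<close> (\<open>three_term_polynomials\<close>); breakdown is excluded because a nonzero
  polynomial of degree below \<open>r\<close> does not vanish at all of the \<open>r\<close> distinct nodes \<open>\<sigma>\<^sub>i\<^sup>2\<close>.  So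
  \<open>S\<^sub>k\<close> consists of the vectors with coordinates \<open>w\<^sub>i p(\<sigma>\<^sub>i\<^sup>2)\<close>, where \<open>p\<close> has degree below \<open>k\<close>
  (\<open>col_space_krylov\<close>).  Such a \<open>p\<close> is determined by its values at the first \<open>k\<close> nodes, which are
  arbitrary; passing from these values to the remaining ones is multiplication by \<open>\<Delta>\<^sub>k\<close>.  Thus
  \<open>S\<^sub>k\<close> is the graph of \<open>\<Delta>\<^sub>k\<close>, padded by zeros, over the first \<open>k\<close> coordinates
  (\<open>krylov_graph\<close>), and \<open>span {z\<^sub>1, \<dots>, z\<^sub>k}\<close> is its base.
  
  A graph vector \<open>(x, \<Delta>\<^sub>k x)\<close> makes with its base the angle \<open>arctan (|\<Delta>\<^sub>k x| / |x|)\<close>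
  (\<open>min_angle_graph\<close>), whose supremum is the arctangent of the norm of \<open>\<Delta>\<^sub>k\<close>
  (\<open>subspace_dist_graph\<close>).  The sine of \<open>arctan s\<close> is \<open>s / sqrt (1 + s\<^sup>2)\<close>.
\<close>

section \<open>Inverses and Euclidean norms\<close>

lemma mat_inv_of_injective:
  assumes C: "C \<in> carrier_mat k k"
    and inj: "\<And>x. x \<in> carrier_vec k \<Longrightarrow> C *\<^sub>v x = 0\<^sub>v k \<Longrightarrow> x = 0\<^sub>v k"
  shows "mat_inv C \<in> carrier_mat k k" "C * mat_inv C = 1\<^sub>m k" "mat_inv C * C = 1\<^sub>m k"
proof -
  have "det C \<noteq> 0"
    using det_0_iff_vec_prod_zero_field[OF C] inj by blast
  then have "C \<in> Units (ring_mat TYPE(real) k undefined)"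
    by (rule det_non_zero_imp_unit[OF C])
  then obtain B where "mat_inverse C = Some B"
    using mat_inverse(1)[OF C, of undefined] by (cases "mat_inverse C") auto
  then show "mat_inv C \<in> carrier_mat k k" "C * mat_inv C = 1\<^sub>m k" "mat_inv C * C = 1\<^sub>m k"
    using mat_inverse(2)[OF C] by (auto simp: mat_inv_def)
qed

lemma left_inverse_injective:
  fixes B C :: "real Matrix.mat"
  assumes "B \<in> carrier_mat k k" "C \<in> carrier_mat k k" "B * C = 1\<^sub>m k"
    and x: "x \<in> carrier_vec k" and "C *\<^sub>v x = 0\<^sub>v k"
  shows "x = 0\<^sub>v k"
proof -
  have "x = (B * C) *\<^sub>v x" using assms by simp
  also have "\<dots> = B *\<^sub>v (C *\<^sub>v x)" using assms(1,2) x by (rule assoc_mult_mat_vec)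
  also have "\<dots> = 0\<^sub>v k" using assms by auto
  finally show ?thesis .
qed

definition euclid_norm :: "real Matrix.vec \<Rightarrow> real" where
  "euclid_norm x = sqrt (scalar_prod x x)"

lemma scalar_prod_self_nonneg: "0 \<le> scalar_prod x (x :: real Matrix.vec)"
  by (auto simp: scalar_prod_def intro!: sum_nonneg)

lemma euclid_norm_nonneg [simp]: "0 \<le> euclid_norm x"
  by (simp add: euclid_norm_def scalar_prod_self_nonneg)

lemma euclid_norm_square: "(euclid_norm x)\<^sup>2 = scalar_prod x x"
  by (simp add: euclid_norm_def scalar_prod_self_nonneg)

lemma euclid_norm_pos:
  assumes "x \<in> carrier_vec k" "x \<noteq> 0\<^sub>v k"
  shows "0 < euclid_norm x"
proof -
  obtain i where "i < k" "x $ i \<noteq> 0" using assms by (metis carrier_vecD eq_vecI index_zero_vec)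
  then have "0 < (\<Sum>i<k. x $ i * x $ i)"
    by (intro sum_pos2[where i = i]) (auto simp: zero_less_mult_iff linorder_neq_iff)
  then show ?thesis
    using assms by (simp add: euclid_norm_def scalar_prod_def atLeast0LessThan)
qed

lemma euclid_norm_zero [simp]: "euclid_norm (0\<^sub>v k) = 0"
  by (simp add: euclid_norm_def)

lemma euclid_norm_smult: "euclid_norm (a \<cdot>\<^sub>v x) = \<bar>a\<bar> * euclid_norm x"
proof -
  have "scalar_prod (a \<cdot>\<^sub>v x) (a \<cdot>\<^sub>v x) = a\<^sup>2 * scalar_prod x x"
    by (simp add: scalar_prod_def sum_distrib_left power2_eq_square ac_simps)
  then show ?thesis by (simp add: euclid_norm_def real_sqrt_mult)
qed

lemma abs_scalar_prod_le:
  assumes "x \<in> carrier_vec k" "y \<in> carrier_vec k"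
  shows "\<bar>scalar_prod x y\<bar> \<le> euclid_norm x * euclid_norm y"
proof -
  have "(scalar_prod x y)\<^sup>2 \<le> (euclid_norm x * euclid_norm y)\<^sup>2"
    using Cauchy_Schwarz_ineq_sum[of "\<lambda>i. x $ i" "\<lambda>i. y $ i" "{0..<k}"] assms
    by (simp add: power_mult_distrib euclid_norm_square)
       (simp add: scalar_prod_def power2_eq_square)
  then show ?thesis by (simp add: abs_le_square_iff[symmetric] abs_mult)
qed

lemma euclid_norm_append:
  "(euclid_norm (x @\<^sub>v y))\<^sup>2 = (euclid_norm x)\<^sup>2 + (euclid_norm y)\<^sup>2"
  unfolding euclid_norm_square
  by (rule scalar_prod_append[of _ "dim_vec x" _ "dim_vec y"]) auto

section \<open>The spectral norm\<close>

lemma spectral_norm_eq: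
  assumes "T \<in> carrier_mat l k"
  shows "spectral_norm T =
    (SUP x \<in> {x \<in> carrier_vec k. euclid_norm x \<le> 1}. euclid_norm (T *\<^sub>v x))"
  using assms by (simp add: spectral_norm_def euclid_norm_def)

text \<open>
  Without boundedness the supremum that defines \<^const>\<open>spectral_norm\<close> carries no
  information.  Cauchy-Schwarz in each row bounds the image of the unit ball by the
  Frobenius norm.
\<close>

lemma bdd_above_unit_ball_image:
  assumes T: "T \<in> carrier_mat l k"
  shows "bdd_above ((\<lambda>x. euclid_norm (T *\<^sub>v x)) ` {x \<in> carrier_vec k. euclid_norm x \<le> 1})"
proof (rule bdd_aboveI2)
  fix x assume x: "x \<in> {x \<in> carrier_vec k. euclid_norm x \<le> 1}"
  have "scalar_prod (T *\<^sub>v x) (T *\<^sub>v x) = (\<Sum>i<l. (scalar_prod (row T i) x)\<^sup>2)"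
    using T by (simp add: scalar_prod_def[of "T *\<^sub>v x"] power2_eq_square atLeast0LessThan)
  also have "\<dots> \<le> (\<Sum>i<l. (euclid_norm (row T i))\<^sup>2)"
  proof (rule sum_mono)
    fix i
    have "\<bar>scalar_prod (row T i) x\<bar> \<le> euclid_norm (row T i) * euclid_norm x"
      using T x by (intro abs_scalar_prod_le[of _ k]) auto
    also have "\<dots> \<le> euclid_norm (row T i)" using x by (simp add: mult_left_le)
    finally show "(scalar_prod (row T i) x)\<^sup>2 \<le> (euclid_norm (row T i))\<^sup>2"
      by (simp add: abs_le_square_iff[symmetric])
  qed
  finally show "euclid_norm (T *\<^sub>v x) \<le> sqrt (\<Sum>i<l. (euclid_norm (row T i))\<^sup>2)"
    by (simp add: euclid_norm_def[of "T *\<^sub>v x"])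
qed

lemma spectral_norm_nonneg:
  assumes T: "T \<in> carrier_mat l k"
  shows "0 \<le> spectral_norm T"
proof -
  have "euclid_norm (T *\<^sub>v 0\<^sub>v k) \<le> spectral_norm T"
    unfolding spectral_norm_eq[OF T]
    by (rule cSUP_upper[OF _ bdd_above_unit_ball_image[OF T]]) auto
  then show ?thesis using euclid_norm_nonneg order_trans by blast
qed

lemma euclid_norm_mult_mat_vec_le:
  assumes T: "T \<in> carrier_mat l k" and x: "x \<in> carrier_vec k"
  shows "euclid_norm (T *\<^sub>v x) \<le> spectral_norm T * euclid_norm x"
proof (cases "x = 0\<^sub>v k")
  case True
  have "T *\<^sub>v x = 0\<^sub>v l" using T True by auto
  then show ?thesis using True by simp
next
  case False
  define y where "y = (1 / euclid_norm x) \<cdot>\<^sub>v x"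
  have pos: "0 < euclid_norm x" using euclid_norm_pos[OF x False] .
  have y: "y \<in> carrier_vec k" "euclid_norm y \<le> 1"
    using x pos by (auto simp: y_def euclid_norm_smult)
  have "T *\<^sub>v y = (1 / euclid_norm x) \<cdot>\<^sub>v (T *\<^sub>v x)"
    unfolding y_def using T x by (rule mult_mat_vec)
  then have "euclid_norm (T *\<^sub>v x) / euclid_norm x = euclid_norm (T *\<^sub>v y)"
    using pos by (simp add: euclid_norm_smult)
  also have "\<dots> \<le> spectral_norm T"
    unfolding spectral_norm_eq[OF T]
    using y by (intro cSUP_upper[OF _ bdd_above_unit_ball_image[OF T]]) auto
  finally show ?thesis using pos by (simp add: divide_le_eq)
qed

lemma spectral_norm_le:
  assumes T: "T \<in> carrier_mat l k" and c: "0 \<le> c"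
    and le: "\<And>x. x \<in> carrier_vec k \<Longrightarrow> euclid_norm (T *\<^sub>v x) \<le> c * euclid_norm x"
  shows "spectral_norm T \<le> c"
  unfolding spectral_norm_eq[OF T]
proof (rule cSUP_least)
  show "{x \<in> carrier_vec k. euclid_norm x \<le> 1} \<noteq> {}"
    using zero_carrier_vec[of k] euclid_norm_zero[of k] by (metis (mono_tags, lifting) empty_Collect_eq zero_le_one)
  fix x assume x: "x \<in> {x \<in> carrier_vec k. euclid_norm x \<le> 1}"
  then have "euclid_norm (T *\<^sub>v x) \<le> c * euclid_norm x" using le by simp
  also have "\<dots> \<le> c" using x c by (simp add: mult_left_le)
  finally show "euclid_norm (T *\<^sub>v x) \<le> c" .
qed

text \<open>
  The subspace \<open>S\<^sub>k\<close> has no component along the last \<open>n - r\<close> columns of \<open>Z\<close>; in the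
  graph below this shows as zero rows under \<open>\<Delta>\<close>, which must not change the norm.
\<close>

lemma spectral_norm_append_zero_rows:
  assumes T: "T \<in> carrier_mat l k"
  shows "spectral_norm (T @\<^sub>r 0\<^sub>m q k) = spectral_norm T"
proof -
  have "euclid_norm ((T @\<^sub>r 0\<^sub>m q k) *\<^sub>v x) = euclid_norm (T *\<^sub>v x)" if x: "x \<in> carrier_vec k" for x
  proof -
    have "(T @\<^sub>r 0\<^sub>m q k) *\<^sub>v x = (T *\<^sub>v x) @\<^sub>v (0\<^sub>m q k *\<^sub>v x)"
      by (rule mat_mult_append[OF T _ x]) auto
    also have "0\<^sub>m q k *\<^sub>v x = 0\<^sub>v q" using x by auto
    finally have "(euclid_norm ((T @\<^sub>r 0\<^sub>m q k) *\<^sub>v x))\<^sup>2 = (euclid_norm (T *\<^sub>v x))\<^sup>2"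
      by (simp add: euclid_norm_append)
    then show ?thesis by simp
  qed
  then show ?thesis
    unfolding spectral_norm_eq[OF T]
    using spectral_norm_eq[of "T @\<^sub>r 0\<^sub>m q k" "l + q" k] T by simp
qed

section \<open>The angle between a graph and its base\<close>

text \<open>
  In coordinates with respect to \<open>B\<close>-orthonormal columns the form \<open>B\<close> is the standard inner
  product, so all angles can be computed in Euclidean space.
\<close>

lemma inner_wrt_coordinates:
  assumes B: "B \<in> carrier_mat n n" and Z: "Z \<in> carrier_mat n n"
    and on: "transpose_mat Z * B * Z = 1\<^sub>m n"
    and c: "c \<in> carrier_vec n" and d: "d \<in> carrier_vec n"
  shows "inner_wrt B (Z *\<^sub>v c) (Z *\<^sub>v d) = scalar_prod c d"
proof -
  have Zt: "transpose_mat Z \<in> carrier_mat n n" using Z by simp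
  have Zd: "B *\<^sub>v (Z *\<^sub>v d) \<in> carrier_vec n" using B Z d by auto
  have "inner_wrt B (Z *\<^sub>v c) (Z *\<^sub>v d) = scalar_prod (B *\<^sub>v (Z *\<^sub>v d)) (Z *\<^sub>v c)"
    unfolding inner_wrt_def using B Z c d by (intro comm_scalar_prod[of _ n]) auto
  also have "\<dots> = scalar_prod (transpose_mat Z *\<^sub>v (B *\<^sub>v (Z *\<^sub>v d))) c"
    using transpose_vec_mult_scalar[OF Z c Zd] by simp
  also have "transpose_mat Z *\<^sub>v (B *\<^sub>v (Z *\<^sub>v d)) = (transpose_mat Z * B * Z) *\<^sub>v d"
    using assoc_mult_mat_vec[OF mult_carrier_mat[OF Zt B] Z d]
      assoc_mult_mat_vec[OF Zt B, of "Z *\<^sub>v d"] Z d by simp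
  also have "\<dots> = d" using d on by simp
  also have "scalar_prod d c = scalar_prod c d" using d c by (rule comm_scalar_prod)
  finally show ?thesis .
qed

lemma arccos_cos_ratio:
  assumes "0 < a" "0 \<le> t"
  shows "arccos (a / sqrt (a\<^sup>2 + t\<^sup>2)) = arctan (t / a)"
proof -
  have "sqrt (1 + (t / a)\<^sup>2) = sqrt (a\<^sup>2 + t\<^sup>2) / a"
  proof -
    have "1 + (t / a)\<^sup>2 = (a\<^sup>2 + t\<^sup>2) / a\<^sup>2" using assms by (simp add: field_simps)
    then show ?thesis using assms by (simp add: real_sqrt_divide)
  qed
  then have "cos (arctan (t / a)) = a / sqrt (a\<^sup>2 + t\<^sup>2)"
    by (simp add: cos_arctan)
  moreover have "0 \<le> arctan (t / a)" "arctan (t / a) \<le> pi"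
    using assms arctan_ubound[of "t / a"] pi_gt_zero by (simp, linarith)
  ultimately show ?thesis by (metis arccos_cos)
qed

text \<open>
  Among the vectors \<open>(y, 0)\<close> the one closest in direction to \<open>(x, t)\<close> is its orthogonal
  projection \<open>(x, 0)\<close>: by Cauchy-Schwarz no other \<open>y\<close> gives a larger cosine.  The angle to the
  projection belongs to a right triangle with legs \<open>|x|\<close> and \<open>|t|\<close>.
\<close>

lemma min_angle_graph:
  assumes B: "B \<in> carrier_mat (k + l) (k + l)" and Z: "Z \<in> carrier_mat (k + l) (k + l)"
    and on: "transpose_mat Z * B * Z = 1\<^sub>m (k + l)"
    and x: "x \<in> carrier_vec k" "x \<noteq> 0\<^sub>v k" and t: "t \<in> carrier_vec l"
  shows "(INF v \<in> {Z *\<^sub>v (y @\<^sub>v 0\<^sub>v l) |y. y \<in> carrier_vec k} - {0\<^sub>v (k + l)}.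
            arccos (\<bar>inner_wrt B (Z *\<^sub>v (x @\<^sub>v t)) v\<bar> /
              (norm_wrt B (Z *\<^sub>v (x @\<^sub>v t)) * norm_wrt B v)))
         = arctan (euclid_norm t / euclid_norm x)" (is "(INF v \<in> ?G. ?angle v) = _")
proof -
  note coords = inner_wrt_coordinates[OF B Z on]
  let ?h = "sqrt ((euclid_norm x)\<^sup>2 + (euclid_norm t)\<^sup>2)"
  have xp: "0 < euclid_norm x" using euclid_norm_pos[OF x] .
  have hp: "0 < ?h" using xp by (simp add: add_pos_nonneg)
  have hx: "euclid_norm x \<le> ?h" by (rule real_le_rsqrt) simp
  have nonzero: "y \<noteq> 0\<^sub>v k \<longleftrightarrow> Z *\<^sub>v (y @\<^sub>v 0\<^sub>v l) \<noteq> 0\<^sub>v (k + l)" if y: "y \<in> carrier_vec k" for y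
  proof
    assume "y \<noteq> 0\<^sub>v k"
    then have "0 < euclid_norm y" using euclid_norm_pos[OF y] by blast
    then have "scalar_prod y y \<noteq> 0" by (simp add: euclid_norm_def)
    moreover have "inner_wrt B (Z *\<^sub>v (y @\<^sub>v 0\<^sub>v l)) (Z *\<^sub>v (y @\<^sub>v 0\<^sub>v l)) = scalar_prod y y"
      using y by (subst coords) (auto simp: scalar_prod_append[of _ k _ l])
    moreover have "inner_wrt B (0\<^sub>v (k + l)) (0\<^sub>v (k + l)) = 0"
      unfolding inner_wrt_def using B by auto
    ultimately show "Z *\<^sub>v (y @\<^sub>v 0\<^sub>v l) \<noteq> 0\<^sub>v (k + l)" by metis
  next
    assume a: "Z *\<^sub>v (y @\<^sub>v 0\<^sub>v l) \<noteq> 0\<^sub>v (k + l)"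
    show "y \<noteq> 0\<^sub>v k"
    proof
      assume "y = 0\<^sub>v k"
      then have "y @\<^sub>v 0\<^sub>v l = 0\<^sub>v (k + l)" by auto
      then show False using a Z by auto
    qed
  qed
  have angle: "?angle (Z *\<^sub>v (y @\<^sub>v 0\<^sub>v l)) = arccos (\<bar>scalar_prod x y\<bar> / (?h * euclid_norm y))"
    if y: "y \<in> carrier_vec k" for y
  proof -
    have "inner_wrt B (Z *\<^sub>v (x @\<^sub>v t)) (Z *\<^sub>v (y @\<^sub>v 0\<^sub>v l)) = scalar_prod x y"
      using x t y by (subst coords) (auto simp: scalar_prod_append[of _ k _ l])
    moreover have "norm_wrt B (Z *\<^sub>v (y @\<^sub>v 0\<^sub>v l)) = euclid_norm y"
      unfolding norm_wrt_def euclid_norm_def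
      using y by (subst coords) (auto simp: scalar_prod_append[of _ k _ l])
    moreover have "norm_wrt B (Z *\<^sub>v (x @\<^sub>v t)) = ?h"
      unfolding norm_wrt_def euclid_norm_square
      using x t by (subst coords) (auto simp: scalar_prod_append[of _ k _ l])
    ultimately show ?thesis by simp
  qed
  have opt: "arctan (euclid_norm t / euclid_norm x) = arccos (euclid_norm x / ?h)"
    using arccos_cos_ratio[OF xp, of "euclid_norm t"] by simp
  show ?thesis
  proof (rule cInf_eq_minimum)
    have "?angle (Z *\<^sub>v (x @\<^sub>v 0\<^sub>v l)) = arctan (euclid_norm t / euclid_norm x)"
    proof -
      have "\<bar>scalar_prod x x\<bar> = euclid_norm x * euclid_norm x"
        using scalar_prod_self_nonneg[of x] euclid_norm_square[of x]
        by (simp add: power2_eq_square)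
      then show ?thesis using xp by (subst angle[OF x(1)]) (simp add: opt)
    qed
    moreover have "Z *\<^sub>v (x @\<^sub>v 0\<^sub>v l) \<in> ?G" using x nonzero by blast
    ultimately show "arctan (euclid_norm t / euclid_norm x) \<in> ?angle ` ?G"
      by (metis (no_types, lifting) image_eqI)
  next
    fix \<theta> assume "\<theta> \<in> ?angle ` ?G"
    then obtain y where y: "y \<in> carrier_vec k" "y \<noteq> 0\<^sub>v k"
      and \<theta>: "\<theta> = ?angle (Z *\<^sub>v (y @\<^sub>v 0\<^sub>v l))"
      using nonzero by blast
    have yp: "0 < euclid_norm y" using euclid_norm_pos[OF y] .
    have "\<bar>scalar_prod x y\<bar> / (?h * euclid_norm y) \<le> euclid_norm x / ?h"
      using abs_scalar_prod_le[OF x(1) y(1)] yp hp by (simp add: field_simps)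
    moreover have "euclid_norm x / ?h \<le> 1" using hx hp by (simp only: divide_le_eq_1_pos)
    moreover have "0 \<le> \<bar>scalar_prod x y\<bar> / (?h * euclid_norm y)"
      using hp yp by (intro divide_nonneg_nonneg mult_nonneg_nonneg) auto
    ultimately show "arctan (euclid_norm t / euclid_norm x) \<le> \<theta>"
      unfolding \<theta> angle[OF y(1)] opt by (intro arccos_le_arccos) linarith+
  qed
qed

text \<open>
  The minimal angle belonging to \<open>x\<close> is \<open>arctan (|T x| / |x|)\<close>.  As \<open>arctan\<close> is increasing
  and the spectral norm is the best constant in \<open>|T x| \<le> s |x|\<close>, the supremum of these angles
  is \<open>arctan s\<close>.
\<close>

lemma subspace_dist_graph:
  assumes B: "B \<in> carrier_mat (k + l) (k + l)" and Z: "Z \<in> carrier_mat (k + l) (k + l)"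
    and on: "transpose_mat Z * B * Z = 1\<^sub>m (k + l)"
    and T: "T \<in> carrier_mat l k" and k: "1 \<le> k"
  shows "subspace_dist B {Z *\<^sub>v (x @\<^sub>v (T *\<^sub>v x)) |x. x \<in> carrier_vec k}
           {Z *\<^sub>v (y @\<^sub>v 0\<^sub>v l) |y. y \<in> carrier_vec k}
         = spectral_norm T / sqrt (1 + (spectral_norm T)\<^sup>2)"
    (is "subspace_dist B ?F ?G = _")
proof -
  define ang where "ang u = (INF v \<in> ?G - {0\<^sub>v (k + l)}.
    arccos (\<bar>inner_wrt B u v\<bar> / (norm_wrt B u * norm_wrt B v)))" for u
  define X :: "real Matrix.vec set" where "X = {x \<in> carrier_vec k. x \<noteq> 0\<^sub>v k}"
  have ang: "ang (Z *\<^sub>v (x @\<^sub>v (T *\<^sub>v x))) = arctan (euclid_norm (T *\<^sub>v x) / euclid_norm x)"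
    if "x \<in> X" for x
    unfolding ang_def using that T by (intro min_angle_graph[OF B Z on]) (auto simp: X_def)
  have F: "?F - {0\<^sub>v (k + l)} = (\<lambda>x. Z *\<^sub>v (x @\<^sub>v (T *\<^sub>v x))) ` X"
  proof -
    have zero: "Z *\<^sub>v (x @\<^sub>v (T *\<^sub>v x)) = 0\<^sub>v (k + l) \<longleftrightarrow> x = 0\<^sub>v k" if x: "x \<in> carrier_vec k"
      for x :: "real Matrix.vec"
    proof
      assume eq: "Z *\<^sub>v (x @\<^sub>v (T *\<^sub>v x)) = 0\<^sub>v (k + l)"
      have ZB: "transpose_mat Z * B \<in> carrier_mat (k + l) (k + l)" using Z B by simp
      have "x @\<^sub>v (T *\<^sub>v x) \<in> carrier_vec (k + l)" using x T by auto
      then have "x @\<^sub>v (T *\<^sub>v x) = 0\<^sub>v (k + l)"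
        using left_inverse_injective[OF ZB Z on _ eq] by blast
      also have "\<dots> = 0\<^sub>v k @\<^sub>v 0\<^sub>v l" by auto
      finally show "x = 0\<^sub>v k" using append_vec_eq[OF x zero_carrier_vec] by blast
    next
      assume "x = 0\<^sub>v k"
      moreover have "T *\<^sub>v 0\<^sub>v k = 0\<^sub>v l" using T by auto
      moreover have "0\<^sub>v k @\<^sub>v 0\<^sub>v l = (0\<^sub>v (k + l) :: real Matrix.vec)" by auto
      ultimately show "Z *\<^sub>v (x @\<^sub>v (T *\<^sub>v x)) = 0\<^sub>v (k + l)" using Z by auto
    qed
    show ?thesis by (auto simp: X_def zero)
  qed
  define \<Theta> where "\<Theta> = (SUP x \<in> X. arctan (euclid_norm (T *\<^sub>v x) / euclid_norm x))"
  let ?s = "spectral_norm T"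
  have s0: "0 \<le> ?s" by (rule spectral_norm_nonneg[OF T])
  have mca: "max_canonical_angle B ?F ?G = \<Theta>"
  proof -
    have "max_canonical_angle B ?F ?G = (SUP u \<in> ?F - {0\<^sub>v (k + l)}. ang u)"
      unfolding max_canonical_angle_def ang_def using B by simp
    also have "\<dots> = \<Theta>" unfolding F \<Theta>_def image_image using ang by (intro SUP_cong) auto
    finally show ?thesis .
  qed
  have pos: "0 < euclid_norm x" if "x \<in> X" for x
    using that euclid_norm_pos by (auto simp: X_def)
  have ub: "arctan (euclid_norm (T *\<^sub>v x) / euclid_norm x) \<le> arctan ?s" if "x \<in> X" for x
  proof -
    have "euclid_norm (T *\<^sub>v x) \<le> ?s * euclid_norm x"
      using that by (intro euclid_norm_mult_mat_vec_le[OF T]) (auto simp: X_def)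
    then show ?thesis using pos[OF that] by (simp add: arctan_le_iff divide_le_eq)
  qed
  have ne: "X \<noteq> {}"
  proof -
    have "unit_vec k 0 \<in> X" using k by (simp add: X_def)
    then show ?thesis by blast
  qed
  have bdd: "bdd_above ((\<lambda>x. arctan (euclid_norm (T *\<^sub>v x) / euclid_norm x)) ` X)"
    using ub by (rule bdd_aboveI2)
  have "\<Theta> = arctan ?s"
  proof (rule antisym)
    show upper: "\<Theta> \<le> arctan ?s" unfolding \<Theta>_def using ne ub by (rule cSUP_least)
    have below: "arctan (euclid_norm (T *\<^sub>v x) / euclid_norm x) \<le> \<Theta>" if "x \<in> X" for x
      unfolding \<Theta>_def by (rule cSUP_upper[OF that bdd])
    have \<Theta>0: "0 \<le> \<Theta>"
    proof -
      obtain x where x: "x \<in> X" using ne by blast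
      have "0 \<le> arctan (euclid_norm (T *\<^sub>v x) / euclid_norm x)" by (simp add: zero_le_arctan_iff)
      then show ?thesis using below[OF x] by linarith
    qed
    have \<Theta>1: "\<Theta> < pi / 2" using upper arctan_ubound[of ?s] by linarith
    have at: "arctan (tan \<Theta>) = \<Theta>" using \<Theta>0 \<Theta>1 by (intro arctan_tan) auto
    \<comment> \<open>The bound \<open>tan \<Theta>\<close> is itself an admissible constant; as \<open>0 \<le> \<Theta> < \<pi>/2\<close>, \<open>arctan\<close> undoes \<open>tan\<close>.\<close>
    have "?s \<le> tan \<Theta>"
    proof (rule spectral_norm_le[OF T])
      show "0 \<le> tan \<Theta>" using \<Theta>0 at zero_le_arctan_iff by metis
      fix x :: "real Matrix.vec" assume x: "x \<in> carrier_vec k"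
      show "euclid_norm (T *\<^sub>v x) \<le> tan \<Theta> * euclid_norm x"
      proof (cases "x \<in> X")
        case True
        then have "euclid_norm (T *\<^sub>v x) / euclid_norm x \<le> tan \<Theta>"
          using below at arctan_le_iff by metis
        then show ?thesis using pos[OF True] by (simp add: divide_le_eq)
      next
        case False
        then have "x = 0\<^sub>v k" using x by (simp add: X_def)
        moreover from this have "T *\<^sub>v x = 0\<^sub>v l" using T by auto
        ultimately show ?thesis by simp
      qed
    qed
    then show "arctan ?s \<le> \<Theta>" using at arctan_le_iff by metis
  qed
  then show ?thesis unfolding subspace_dist_def mca by (simp add: sin_arctan)
qed

section \<open>Krylov vectors as polynomials\<close>

lemma polynomial_combination:
  fixes q :: "nat \<Rightarrow> 'a :: field poly"
  assumes "\<And>i. i < k \<Longrightarrow> q i \<noteq> 0 \<and> degree (q i) = i"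
    and "\<And>i. k \<le> i \<Longrightarrow> poly.coeff p i = 0"
  shows "\<exists>c. p = (\<Sum>i<k. Polynomial.smult (c i) (q i))"
  using assms
proof (induction k arbitrary: p)
  case 0
  then have "p = 0" by (intro poly_eqI) simp
  then show ?case by simp
next
  case (Suc k)
  define a where "a = poly.coeff p k / poly.coeff (q k) k"
  have qk: "poly.coeff (q k) k \<noteq> 0" "degree (q k) = k"
    using Suc.prems(1)[of k] leading_coeff_0_iff[of "q k"] by auto
  have "poly.coeff (p - Polynomial.smult a (q k)) i = 0" if "k \<le> i" for i
  proof (cases "i = k")
    case True
    then show ?thesis using qk by (simp add: a_def)
  next
    case False
    then show ?thesis using that Suc.prems(2) qk by (simp add: coeff_eq_0)
  qed
  then obtain c where c: "p - Polynomial.smult a (q k) = (\<Sum>i<k. Polynomial.smult (c i) (q i))"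
    using Suc.IH[of "p - Polynomial.smult a (q k)"] Suc.prems(1) by auto
  have "p = (\<Sum>i<Suc k. Polynomial.smult ((c(k := a)) i) (q i))"
    using c by (simp add: algebra_simps)
  then show ?case by blast
qed

lemma poly_eq_0_of_distinct_nodes:
  fixes p :: "'a :: idom poly"
  assumes "inj_on s {..<r}" "\<And>j. j < r \<Longrightarrow> poly p (s j) = 0"
    and "\<And>i. r \<le> i \<Longrightarrow> poly.coeff p i = 0"
  shows "p = 0"
proof (rule ccontr)
  assume "p \<noteq> 0"
  then have "degree p < r" using assms(3) by (meson leading_coeff_0_iff not_le)
  moreover have "card (s ` {..<r}) = r" using assms(1) by (simp add: card_image)
  ultimately have "p = 0"
    using assms(2) by (intro poly_eqI_degree[of "s ` {..<r}"]) auto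
  then show False using \<open>p \<noteq> 0\<close> by simp
qed

text \<open>
  The coordinates, with respect to the columns of \<open>Z\<close>, of \<open>p (A\<^sup>* A) A\<^sup>* b\<close>: in these coordinates
  \<open>A\<^sup>* A\<close> is diagonal with entries \<open>s j\<close> and \<open>A\<^sup>* b\<close> has the entries \<open>w j\<close> for \<open>j < r\<close>, and both
  have zeros from \<open>r\<close> on.
\<close>

definition krylov_coords ::
  "nat \<Rightarrow> nat \<Rightarrow> (nat \<Rightarrow> real) \<Rightarrow> (nat \<Rightarrow> real) \<Rightarrow> real poly \<Rightarrow> real Matrix.vec" where
  "krylov_coords n r w s p = Matrix.vec n (\<lambda>j. if j < r then w j * poly p (s j) else 0)"

lemma krylov_coords_carrier [simp]: "krylov_coords n r w s p \<in> carrier_vec n"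
  by (simp add: krylov_coords_def)

lemma krylov_coords_dim [simp]: "dim_vec (krylov_coords n r w s p) = n"
  by (simp add: krylov_coords_def)

lemma krylov_coords_smult:
  "krylov_coords n r w s (Polynomial.smult a p) = a \<cdot>\<^sub>v krylov_coords n r w s p"
  by (rule eq_vecI) (auto simp: krylov_coords_def)

lemma krylov_coords_diff:
  "krylov_coords n r w s (p - q) = krylov_coords n r w s p - krylov_coords n r w s q"
  by (rule eq_vecI) (auto simp: krylov_coords_def algebra_simps)

lemma krylov_coords_0: "krylov_coords n r w s 0 = 0\<^sub>v n"
  by (rule eq_vecI) (auto simp: krylov_coords_def)

text \<open>
  A nonzero polynomial of degree below \<open>r\<close> cannot vanish at \<open>r\<close> distinct nodes, and no weight
  \<open>w j\<close> hides the value at its node.  This is why the bidiagonalization cannot break down in its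
  first \<open>r\<close> steps.
\<close>

lemma krylov_coords_eq_0:
  assumes "krylov_coords n r w s p = 0\<^sub>v n" "r \<le> n" "inj_on s {..<r}"
    and w: "\<And>j. j < r \<Longrightarrow> w j \<noteq> 0"
    and "\<And>i. r \<le> i \<Longrightarrow> poly.coeff p i = 0"
  shows "p = 0"
proof (rule poly_eq_0_of_distinct_nodes[OF assms(3)])
  fix j assume j: "j < r"
  then have "krylov_coords n r w s p $ j = 0" using assms by simp
  then show "poly p (s j) = 0" using j w assms(2) by (simp add: krylov_coords_def)
qed fact

text \<open>
  Read on polynomials, the recurrence multiplies by the variable and subtracts terms of lower
  degree, so the right-hand side for index \<open>i + 1\<close> is a polynomial of degree exactly \<open>i\<close>.  As
  \<open>i < r\<close>, its vector is nonzero; hence the scalar \<open>c\<close> on the left is nonzero and may be divided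
  out.
\<close>

lemma three_term_polynomials:
  fixes Z :: "real Matrix.mat" and v :: "nat \<Rightarrow> real Matrix.vec"
  assumes Z: "Z \<in> carrier_mat n n"
    and Zinj: "\<And>c. c \<in> carrier_vec n \<Longrightarrow> Z *\<^sub>v c = 0\<^sub>v n \<Longrightarrow> c = 0\<^sub>v n"
    and rn: "r \<le> n" and kr: "k \<le> r"
    and s: "inj_on s {..<r}" and w: "\<And>j. j < r \<Longrightarrow> w j \<noteq> 0"
    and v: "\<And>i. i \<in> {1..k} \<Longrightarrow> v i \<in> carrier_vec n"
    and v0: "v 0 = 0\<^sub>v n"
    and v1: "1 \<le> k \<Longrightarrow> c 1 \<cdot>\<^sub>v v 1 = Z *\<^sub>v krylov_coords n r w s 1"
    and L: "\<And>p. L (Z *\<^sub>v krylov_coords n r w s p) = Z *\<^sub>v krylov_coords n r w s ([:0, 1:] * p)"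
    and step: "\<And>i. 1 \<le> i \<Longrightarrow> i < k \<Longrightarrow>
      c (Suc i) \<cdot>\<^sub>v v (Suc i) = L (v i) - d i \<cdot>\<^sub>v v i - e i \<cdot>\<^sub>v v (i - 1)"
    and i: "i < k"
  shows "\<exists>q. v (Suc i) = Z *\<^sub>v krylov_coords n r w s q \<and> q \<noteq> 0 \<and> degree q = i"
  using i
proof (induction i rule: less_induct)
  case (less i)
  let ?K = "krylov_coords n r w s"
  have "\<exists>g. c (Suc i) \<cdot>\<^sub>v v (Suc i) = Z *\<^sub>v ?K g \<and> g \<noteq> 0 \<and> degree g = i"
  proof (cases i)
    case 0
    have "c (Suc i) \<cdot>\<^sub>v v (Suc i) = Z *\<^sub>v ?K 1" using v1 0 less.prems by simp
    then show ?thesis using 0 by (intro exI[of _ 1]) simp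
  next
    case (Suc h)
    obtain q where q: "v i = Z *\<^sub>v ?K q" "q \<noteq> 0" "degree q = h"
      using less.IH[of h] less.prems Suc by auto
    \<comment> \<open>At the start of the recurrence \<open>v 0 = 0\<close> belongs to the zero polynomial.\<close>
    obtain q' where q': "v h = Z *\<^sub>v ?K q'" "q' = 0 \<or> degree q' < h"
    proof (cases h)
      case 0
      have "v h = Z *\<^sub>v ?K 0" using v0 0 Z by (auto simp: krylov_coords_0)
      then show ?thesis using that by blast
    next
      case (Suc h')
      then show ?thesis using less.IH[of h'] less.prems \<open>i = Suc h\<close> that by auto
    qed
    \<comment> \<open>The part of lower degree, split off to read off the degree of \<open>g\<close>.\<close>
    define f where "f = Polynomial.smult (d i) q + Polynomial.smult (e i) q'"
    define g where "g = [:0, 1:] * q - Polynomial.smult (d i) q - Polynomial.smult (e i) q'"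
    have lin: "Z *\<^sub>v ?K (p1 - Polynomial.smult a p2) = Z *\<^sub>v ?K p1 - a \<cdot>\<^sub>v (Z *\<^sub>v ?K p2)" for p1 p2 a
      using Z by (simp add: krylov_coords_diff krylov_coords_smult
          mult_minus_distrib_mat_vec[of Z n n] mult_mat_vec[of Z n n])
    have "c (Suc i) \<cdot>\<^sub>v v (Suc i) = Z *\<^sub>v ?K g"
    proof -
      have "c (Suc i) \<cdot>\<^sub>v v (Suc i) = L (v i) - d i \<cdot>\<^sub>v v i - e i \<cdot>\<^sub>v v h"
        using step[of i] less.prems Suc by simp
      then show ?thesis unfolding q(1) q'(1) L g_def lin .
    qed
    moreover have "degree f < Suc h"
      using q(3) q'(2) unfolding f_def
      by (intro degree_add_less) (auto intro: le_less_trans[OF degree_smult_le])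
    moreover have "degree ([:0, 1:] * q) = Suc h"
      using q by (simp add: degree_mult_eq)
    moreover have "g = [:0, 1:] * q + (- f)" by (simp add: g_def f_def)
    ultimately have "c (Suc i) \<cdot>\<^sub>v v (Suc i) = Z *\<^sub>v ?K g \<and> degree g = Suc h"
      using degree_add_eq_left[of "- f" "[:0, 1:] * q"] by simp
    then show ?thesis using Suc by (intro exI[of _ g]) auto
  qed
  then obtain g where g: "c (Suc i) \<cdot>\<^sub>v v (Suc i) = Z *\<^sub>v ?K g" "g \<noteq> 0" "degree g = i" by blast
  have vi: "v (Suc i) \<in> carrier_vec n" using v less.prems by simp
  have nz: "c (Suc i) \<noteq> 0"
  proof
    assume "c (Suc i) = 0"
    moreover have "0 \<cdot>\<^sub>v v (Suc i) = 0\<^sub>v n" using vi by (intro eq_vecI) auto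
    ultimately have "Z *\<^sub>v ?K g = 0\<^sub>v n" using g(1) by simp
    then have "?K g = 0\<^sub>v n" by (rule Zinj[OF krylov_coords_carrier])
    then have "g = 0"
      using g(3) less.prems kr
      by (intro krylov_coords_eq_0[OF _ rn s w]) (auto intro: coeff_eq_0)
    then show False using g(2) by simp
  qed
  have "v (Suc i) = (1 / c (Suc i)) \<cdot>\<^sub>v (c (Suc i) \<cdot>\<^sub>v v (Suc i))"
    using nz by (simp add: smult_smult_assoc)
  also have "\<dots> = Z *\<^sub>v ?K (Polynomial.smult (1 / c (Suc i)) g)"
    unfolding g(1) krylov_coords_smult using Z by (simp add: mult_mat_vec[of Z n n])
  finally show ?case
    using g nz by (intro exI[of _ "Polynomial.smult (1 / c (Suc i)) g"]) simp
qed

text \<open>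
  Polynomials with degrees \<open>0, \<dots>, k - 1\<close> form a basis of the polynomials of degree below \<open>k\<close>,
  whose vectors therefore make up the whole span.
\<close>

lemma col_space_krylov:
  fixes Z :: "real Matrix.mat" and v :: "nat \<Rightarrow> real Matrix.vec"
  assumes Z: "Z \<in> carrier_mat n n"
    and q: "\<And>i. i < k \<Longrightarrow> v (Suc i) = Z *\<^sub>v krylov_coords n r w s (q i) \<and> q i \<noteq> 0 \<and> degree (q i) = i"
  shows "vec_space.col_space n (mat_of_cols n (map v [1..<Suc k])) =
         {Z *\<^sub>v krylov_coords n r w s p |p. \<forall>i \<ge> k. poly.coeff p i = 0}"
proof -
  interpret vec_space "TYPE(real)" n .
  let ?K = "krylov_coords n r w s"
  let ?V = "mat_of_cols n (map v [1..<Suc k])"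
  have V: "?V \<in> carrier_mat n k" using mat_of_cols_carrier(1)[of n "map v [1..<Suc k]"]
    by (simp del: upt_Suc)
  have Vx: "?V *\<^sub>v Matrix.vec k x = Z *\<^sub>v ?K (\<Sum>i<k. Polynomial.smult (x i) (q i))" for x
  proof (rule eq_vecI)
    fix a assume "a < dim_vec (Z *\<^sub>v ?K (\<Sum>i<k. Polynomial.smult (x i) (q i)))"
    then have a: "a < n" using Z by simp
    have ent: "?V $$ (a, i) = (\<Sum>j<n. Z $$ (a, j) * ?K (q i) $ j)" if "i < k" for i
    proof -
      have "?V $$ (a, i) = v (Suc i) $ a" using a that by (simp add: mat_of_cols_def del: upt_Suc)
      also have "\<dots> = (\<Sum>j<n. Z $$ (a, j) * ?K (q i) $ j)"
        using q[OF that] a Z by (simp add: scalar_prod_def atLeast0LessThan)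
      finally show ?thesis .
    qed
    have sumK: "?K (\<Sum>i<k. Polynomial.smult (x i) (q i)) $ j = (\<Sum>i<k. x i * ?K (q i) $ j)" if "j < n" for j
      using that by (simp add: krylov_coords_def poly_sum sum_distrib_left ac_simps)
    have "(?V *\<^sub>v Matrix.vec k x) $ a = (\<Sum>i<k. ?V $$ (a, i) * x i)"
      using a V by (simp add: scalar_prod_def atLeast0LessThan del: upt_Suc)
    also have "\<dots> = (\<Sum>i<k. \<Sum>j<n. Z $$ (a, j) * ?K (q i) $ j * x i)"
      by (intro sum.cong refl) (simp only: lessThan_iff ent sum_distrib_right)
    also have "\<dots> = (\<Sum>j<n. \<Sum>i<k. Z $$ (a, j) * ?K (q i) $ j * x i)" by (rule sum.swap)
    also have "\<dots> = (\<Sum>j<n. Z $$ (a, j) * ?K (\<Sum>i<k. Polynomial.smult (x i) (q i)) $ j)"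
      by (simp add: sumK sum_distrib_left ac_simps)
    also have "\<dots> = (Z *\<^sub>v ?K (\<Sum>i<k. Polynomial.smult (x i) (q i))) $ a"
      using a Z by (simp add: scalar_prod_def atLeast0LessThan)
    finally show "(?V *\<^sub>v Matrix.vec k x) $ a = (Z *\<^sub>v ?K (\<Sum>i<k. Polynomial.smult (x i) (q i))) $ a" .
  qed (use Z V in simp)
  have cs: "col_space ?V = {?V *\<^sub>v x |x. x \<in> carrier_vec k}"
    unfolding col_space_eq[OF V] using V by (auto simp del: upt_Suc)
  show ?thesis
    unfolding cs
  proof (intro equalityI subsetI)
    fix y assume "y \<in> {?V *\<^sub>v x |x. x \<in> carrier_vec k}"
    then obtain x where x: "x \<in> carrier_vec k" "y = ?V *\<^sub>v x" by blast
    have "x = Matrix.vec k (\<lambda>i. x $ i)" using x by auto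
    then have "y = Z *\<^sub>v ?K (\<Sum>i<k. Polynomial.smult (x $ i) (q i))" using x Vx by metis
    moreover have "poly.coeff (\<Sum>i<k. Polynomial.smult (x $ i) (q i)) j = 0" if "k \<le> j" for j
      unfolding coeff_sum using that q by (intro sum.neutral) (auto simp: coeff_eq_0)
    ultimately show "y \<in> {Z *\<^sub>v ?K p |p. \<forall>i \<ge> k. poly.coeff p i = 0}" by blast
  next
    fix y assume "y \<in> {Z *\<^sub>v ?K p |p. \<forall>i \<ge> k. poly.coeff p i = 0}"
    then obtain p where p: "y = Z *\<^sub>v ?K p" "\<And>i. k \<le> i \<Longrightarrow> poly.coeff p i = 0" by blast
    obtain x where "p = (\<Sum>i<k. Polynomial.smult (x i) (q i))"
      using polynomial_combination[of k q p] q p(2) by blast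
    then have "y = ?V *\<^sub>v Matrix.vec k x" using Vx p(1) by simp
    then show "y \<in> {?V *\<^sub>v x |x. x \<in> carrier_vec k}" by auto
  qed
qed

lemma poly_eq_sum_coeffs:
  fixes p :: "real poly"
  assumes "\<And>i. k \<le> i \<Longrightarrow> poly.coeff p i = 0"
  shows "poly p x = (\<Sum>j<k. x ^ j * poly.coeff p j)"
proof -
  have "poly p x = (\<Sum>j\<le>degree p. poly.coeff p j * x ^ j)" by (rule poly_altdef)
  also have "\<dots> = (\<Sum>j \<in> {..degree p} \<union> {..<k}. poly.coeff p j * x ^ j)"
    by (intro sum.mono_neutral_left) (auto intro: coeff_eq_0)
  also have "\<dots> = (\<Sum>j<k. poly.coeff p j * x ^ j)"
    using assms by (intro sum.mono_neutral_right) auto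
  finally show ?thesis by (simp add: mult.commute)
qed

text \<open>
  If \<open>a\<close> is the coefficient vector of \<open>p\<close>, the first \<open>r\<close> coordinates of the Krylov vector are
  \<open>D H a\<close>, that is \<open>D\<^sub>1 H\<^sub>1 a\<close> above \<open>D\<^sub>2 H\<^sub>2 a\<close>.  Both \<open>D\<^sub>1\<close> (nonzero diagonal) and \<open>H\<^sub>1\<close>
  (Vandermonde matrix of distinct nodes) are invertible, so \<open>x = D\<^sub>1 H\<^sub>1 a\<close> ranges over everything
  and determines the lower block as \<open>\<Delta> x\<close>.
\<close>

lemma krylov_graph:
  fixes D1 D2 H1 H2 :: "real Matrix.mat"
  assumes rn: "r \<le> n" and kr: "k \<le> r"
    and s: "inj_on s {..<r}" and w: "\<And>j. j < r \<Longrightarrow> w j \<noteq> 0"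
    and D1: "D1 \<in> carrier_mat k k" and D2: "D2 \<in> carrier_mat (r - k) (r - k)"
    and D: "mat_diag r w = four_block_mat D1 (0\<^sub>m k (r - k)) (0\<^sub>m (r - k) k) D2"
    and H1: "H1 \<in> carrier_mat k k" and H2: "H2 \<in> carrier_mat (r - k) k"
    and H: "Matrix.mat r k (\<lambda>(i, j). s i ^ j) = H1 @\<^sub>r H2"
    and \<Delta>: "\<Delta> = D2 * H2 * mat_inv H1 * mat_inv D1"
  shows "\<Delta> \<in> carrier_mat (r - k) k"
    and "{krylov_coords n r w s p |p. \<forall>i \<ge> k. poly.coeff p i = 0} =
         {x @\<^sub>v ((\<Delta> @\<^sub>r 0\<^sub>m (n - r) k) *\<^sub>v x) |x. x \<in> carrier_vec k}"
proof -
  have D1_entry: "D1 $$ (i, j) = (if i = j then w j else 0)" if "i < k" "j < k" for i j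
  proof -
    have "D1 $$ (i, j) = mat_diag r w $$ (i, j)" unfolding D using that D1 D2 by simp
    then show ?thesis using that kr by (simp add: mat_diag_def)
  qed
  have H1_entry: "H1 $$ (i, j) = s i ^ j" if "i < k" "j < k" for i j
  proof -
    have "H1 $$ (i, j) = (H1 @\<^sub>r H2) $$ (i, j)"
      unfolding append_rows_def using that H1 H2 by simp
    then show ?thesis unfolding H[symmetric] using that kr by simp
  qed
  have D1_inj: "x = 0\<^sub>v k" if x: "x \<in> carrier_vec k" and eq: "D1 *\<^sub>v x = 0\<^sub>v k" for x
  proof (rule eq_vecI)
    fix i assume "i < dim_vec (0\<^sub>v k)"
    then have i: "i < k" by simp
    have "(D1 *\<^sub>v x) $ i = (\<Sum>j<k. D1 $$ (i, j) * x $ j)"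
      using i x D1 by (simp add: scalar_prod_def atLeast0LessThan)
    also have "\<dots> = (\<Sum>j<k. if j = i then w i * x $ i else 0)"
      using i by (intro sum.cong) (auto simp: D1_entry)
    also have "\<dots> = w i * x $ i" using i by simp
    finally show "x $ i = 0\<^sub>v k $ i" using eq i w[of i] kr by simp
  qed (use x in simp)
  have H1_inj: "x = 0\<^sub>v k" if x: "x \<in> carrier_vec k" and eq: "H1 *\<^sub>v x = 0\<^sub>v k" for x
  proof -
    define p where "p = (\<Sum>j<k. Polynomial.monom (x $ j) j)"
    have cp: "poly.coeff p j = (if j < k then x $ j else 0)" for j
      unfolding p_def by (simp add: coeff_sum)
    have "p = 0"
    proof (rule poly_eq_0_of_distinct_nodes)
      show "inj_on s {..<k}" using s by (rule inj_on_subset) (use kr in auto)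
      fix i assume i: "i < k"
      have "poly p (s i) = (\<Sum>j<k. s i ^ j * poly.coeff p j)" by (rule poly_eq_sum_coeffs) (simp add: cp)
      also have "\<dots> = (H1 *\<^sub>v x) $ i"
        using i x H1 by (simp add: scalar_prod_def atLeast0LessThan cp H1_entry)
      finally show "poly p (s i) = 0" using eq i by simp
    qed (simp add: cp)
    then have "x $ j = 0" if "j < k" for j using cp[of j] that by simp
    then show ?thesis using x by auto
  qed
  note D1_inv = mat_inv_of_injective[OF D1 D1_inj] and H1_inv = mat_inv_of_injective[OF H1 H1_inj]
  show \<Delta>_carrier: "\<Delta> \<in> carrier_mat (r - k) k" unfolding \<Delta>
    by (rule mult_carrier_mat[OF mult_carrier_mat[OF mult_carrier_mat[OF D2 H2] H1_inv(1)] D1_inv(1)])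
  have \<Delta>_mult: "\<Delta> *\<^sub>v (D1 *\<^sub>v (H1 *\<^sub>v a)) = D2 *\<^sub>v (H2 *\<^sub>v a)" if a: "a \<in> carrier_vec k" for a
  proof -
    have Ha: "H1 *\<^sub>v a \<in> carrier_vec k" using H1 a by simp
    have Da: "D1 *\<^sub>v (H1 *\<^sub>v a) \<in> carrier_vec k" using D1 Ha by simp
    have "mat_inv D1 *\<^sub>v (D1 *\<^sub>v (H1 *\<^sub>v a)) = H1 *\<^sub>v a"
      using assoc_mult_mat_vec[OF D1_inv(1) D1 Ha] D1_inv(3) Ha by simp
    moreover have "mat_inv H1 *\<^sub>v (H1 *\<^sub>v a) = a"
      using assoc_mult_mat_vec[OF H1_inv(1) H1 a] H1_inv(3) a by simp
    moreover have DH: "D2 * H2 \<in> carrier_mat (r - k) k" using D2 H2 by simp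
    have "\<Delta> *\<^sub>v (D1 *\<^sub>v (H1 *\<^sub>v a)) =
        (D2 * H2 * mat_inv H1) *\<^sub>v (mat_inv D1 *\<^sub>v (D1 *\<^sub>v (H1 *\<^sub>v a)))"
      unfolding \<Delta> using mult_carrier_mat[OF DH H1_inv(1)] D1_inv(1) Da by (rule assoc_mult_mat_vec)
    moreover have "(D2 * H2 * mat_inv H1) *\<^sub>v (H1 *\<^sub>v a) = (D2 * H2) *\<^sub>v (mat_inv H1 *\<^sub>v (H1 *\<^sub>v a))"
      using DH H1_inv(1) Ha by (rule assoc_mult_mat_vec)
    moreover have "(D2 * H2) *\<^sub>v a = D2 *\<^sub>v (H2 *\<^sub>v a)" using D2 H2 a by (rule assoc_mult_mat_vec)
    ultimately show ?thesis by simp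
  qed
  have coords: "krylov_coords n r w s p = x @\<^sub>v ((\<Delta> @\<^sub>r 0\<^sub>m (n - r) k) *\<^sub>v x)"
    if p: "\<And>i. k \<le> i \<Longrightarrow> poly.coeff p i = 0" and x: "x = D1 *\<^sub>v (H1 *\<^sub>v Matrix.vec k (poly.coeff p))"
    for p x
  proof -
    define a where "a = Matrix.vec k (poly.coeff p)"
    have a: "a \<in> carrier_vec k" by (simp add: a_def)
    have xc: "x \<in> carrier_vec k" unfolding x using D1 H1 by simp
    have DHa: "mat_diag r w *\<^sub>v (Matrix.mat r k (\<lambda>(i, j). s i ^ j) *\<^sub>v a) = x @\<^sub>v (\<Delta> *\<^sub>v x)"
    proof -
      have "(H1 @\<^sub>r H2) *\<^sub>v a = (H1 *\<^sub>v a) @\<^sub>v (H2 *\<^sub>v a)" by (rule mat_mult_append[OF H1 H2 a])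
      moreover have "mat_diag r w *\<^sub>v ((H1 *\<^sub>v a) @\<^sub>v (H2 *\<^sub>v a)) = (D1 *\<^sub>v (H1 *\<^sub>v a)) @\<^sub>v (D2 *\<^sub>v (H2 *\<^sub>v a))"
        unfolding D using H1 H2 a by (intro mult_mat_vec_split[OF D1 D2]) auto
      ultimately show ?thesis using \<Delta>_mult[OF a] by (simp add: H x a_def)
    qed
    have entry: "(x @\<^sub>v (\<Delta> *\<^sub>v x)) $ j = w j * poly p (s j)" if j: "j < r" for j
    proof -
      have "(Matrix.mat r k (\<lambda>(i, j). s i ^ j) *\<^sub>v a) $ j = poly p (s j)"
        using j poly_eq_sum_coeffs[OF p, where x = "s j"] by (simp add: scalar_prod_def a_def atLeast0LessThan)
      moreover have "(mat_diag r w *\<^sub>v y) $ j = w j * y $ j" if "y \<in> carrier_vec r" for y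
      proof -
        have "(mat_diag r w *\<^sub>v y) $ j = (\<Sum>i<r. (if j = i then w i else 0) * y $ i)"
          using j that by (simp add: scalar_prod_def mat_diag_def atLeast0LessThan)
        also have "\<dots> = (\<Sum>i<r. if i = j then w j * y $ j else 0)"
          by (intro sum.cong) auto
        finally have "(mat_diag r w *\<^sub>v y) $ j = (\<Sum>i<r. if i = j then w j * y $ j else 0)" .
        then show ?thesis using j by simp
      qed
      moreover have "Matrix.mat r k (\<lambda>(i, j). s i ^ j) *\<^sub>v a \<in> carrier_vec r"
        using mult_mat_vec_carrier[OF mat_carrier a] .
      ultimately show ?thesis unfolding DHa[symmetric] by metis
    qed
    have "(\<Delta> @\<^sub>r 0\<^sub>m (n - r) k) *\<^sub>v x = (\<Delta> *\<^sub>v x) @\<^sub>v (0\<^sub>m (n - r) k *\<^sub>v x)"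
      by (rule mat_mult_append[OF \<Delta>_carrier _ xc]) auto
    also have "0\<^sub>m (n - r) k *\<^sub>v x = 0\<^sub>v (n - r)" using xc by auto
    finally have split: "(\<Delta> @\<^sub>r 0\<^sub>m (n - r) k) *\<^sub>v x = (\<Delta> *\<^sub>v x) @\<^sub>v 0\<^sub>v (n - r)" .
    have dims: "dim_vec x = k" "dim_row \<Delta> = r - k" using xc \<Delta>_carrier by auto
    show ?thesis
      unfolding split
    proof (rule eq_vecI)
      fix j assume "j < dim_vec (x @\<^sub>v ((\<Delta> *\<^sub>v x) @\<^sub>v 0\<^sub>v (n - r)))"
      then have j: "j < n" using dims kr rn by simp
      have "(x @\<^sub>v ((\<Delta> *\<^sub>v x) @\<^sub>v 0\<^sub>v (n - r))) $ j = (if j < r then (x @\<^sub>v (\<Delta> *\<^sub>v x)) $ j else 0)"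
        using j dims kr rn by (auto simp: index_append_vec)
      then show "krylov_coords n r w s p $ j = (x @\<^sub>v ((\<Delta> *\<^sub>v x) @\<^sub>v 0\<^sub>v (n - r))) $ j"
        using j entry by (simp add: krylov_coords_def)
    qed (use dims kr rn in simp)
  qed
  show "{krylov_coords n r w s p |p. \<forall>i \<ge> k. poly.coeff p i = 0} =
        {x @\<^sub>v ((\<Delta> @\<^sub>r 0\<^sub>m (n - r) k) *\<^sub>v x) |x. x \<in> carrier_vec k}"
  proof (intro equalityI subsetI)
    fix y assume "y \<in> {krylov_coords n r w s p |p. \<forall>i \<ge> k. poly.coeff p i = 0}"
    then obtain p where p: "y = krylov_coords n r w s p" "\<And>i. k \<le> i \<Longrightarrow> poly.coeff p i = 0" by blast
    have "D1 *\<^sub>v (H1 *\<^sub>v Matrix.vec k (poly.coeff p)) \<in> carrier_vec k" using D1 H1 by simp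
    then show "y \<in> {x @\<^sub>v ((\<Delta> @\<^sub>r 0\<^sub>m (n - r) k) *\<^sub>v x) |x. x \<in> carrier_vec k}"
      using coords[OF p(2) refl] p(1) by blast
  next
    fix y assume "y \<in> {x @\<^sub>v ((\<Delta> @\<^sub>r 0\<^sub>m (n - r) k) *\<^sub>v x) |x. x \<in> carrier_vec k}"
    then obtain x where y: "y = x @\<^sub>v ((\<Delta> @\<^sub>r 0\<^sub>m (n - r) k) *\<^sub>v x)" and x: "x \<in> carrier_vec k" by blast
    define a where "a = mat_inv H1 *\<^sub>v (mat_inv D1 *\<^sub>v x)"
    define p where "p = (\<Sum>j<k. Polynomial.monom (a $ j) j)"
    have cp: "poly.coeff p j = (if j < k then a $ j else 0)" for j
      unfolding p_def by (simp add: coeff_sum)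
    have a: "a \<in> carrier_vec k" unfolding a_def using H1_inv(1) D1_inv(1) x by simp
    have av: "Matrix.vec k (poly.coeff p) = a" using a by (intro eq_vecI) (auto simp: cp)
    have dx: "mat_inv D1 *\<^sub>v x \<in> carrier_vec k" using D1_inv(1) x by simp
    have "H1 *\<^sub>v a = mat_inv D1 *\<^sub>v x"
      unfolding a_def using assoc_mult_mat_vec[OF H1 H1_inv(1) dx] H1_inv(2) dx by simp
    moreover have "D1 *\<^sub>v (mat_inv D1 *\<^sub>v x) = x"
      using assoc_mult_mat_vec[OF D1 D1_inv(1) x] D1_inv(2) x by simp
    ultimately have "krylov_coords n r w s p = y"
      unfolding y by (intro coords) (auto simp: cp av)
    moreover have "\<forall>i \<ge> k. poly.coeff p i = 0" by (simp add: cp)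
    ultimately show "y \<in> {krylov_coords n r w s p |p. \<forall>i \<ge> k. poly.coeff p i = 0}" by blast
  qed
qed

section \<open>The operator of the bidiagonalization in GSVD coordinates\<close>

definition rect_diag :: "nat \<Rightarrow> nat \<Rightarrow> nat \<Rightarrow> (nat \<Rightarrow> real) \<Rightarrow> real Matrix.mat" where
  "rect_diag a b r f = Matrix.mat a b (\<lambda>(i, j). if i = j \<and> j < r then f j else 0)"

lemma rect_diag_carrier [simp]: "rect_diag a b r f \<in> carrier_mat a b"
  by (simp add: rect_diag_def)

lemma transpose_rect_diag: "transpose_mat (rect_diag a b r f) = rect_diag b a r f"
  by (rule eq_matI) (auto simp: rect_diag_def)

lemma rect_diag_mult_vec:
  assumes "r \<le> b" "y \<in> carrier_vec b"
  shows "rect_diag a b r f *\<^sub>v y = Matrix.vec a (\<lambda>i. if i < r then f i * y $ i else 0)"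
proof (rule eq_vecI)
  fix i assume "i < dim_vec (Matrix.vec a (\<lambda>i. if i < r then f i * y $ i else 0))"
  then have i: "i < a" by simp
  have "(rect_diag a b r f *\<^sub>v y) $ i = (\<Sum>j<b. (if i = j \<and> j < r then f j else 0) * y $ j)"
    using i assms(2) by (simp add: rect_diag_def scalar_prod_def atLeast0LessThan)
  also have "\<dots> = (\<Sum>j<b. if j = i then (if i < r then f i * y $ i else 0) else 0)"
    by (intro sum.cong) auto
  also have "\<dots> = (if i < r then f i * y $ i else 0)" using assms(1) by simp
  finally show "(rect_diag a b r f *\<^sub>v y) $ i = Matrix.vec a (\<lambda>i. if i < r then f i * y $ i else 0) $ i"
    using i by simp
qed (simp add: rect_diag_def)

lemma four_block_rect_diag:
  assumes "r \<le> a" "r \<le> b"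
  shows "four_block_mat (mat_diag r f) (0\<^sub>m r (b - r)) (0\<^sub>m (a - r) r) (0\<^sub>m (a - r) (b - r)) = rect_diag a b r f"
  using assms by (intro eq_matI) (auto simp: rect_diag_def mat_diag_def)

text \<open>
  In GSVD coordinates the adjoint \<open>A\<^sup>* = N A\<^sup>T M\<^sup>-\<^sup>1\<close> is the transpose of the diagonal factor,
  since \<open>N = Z Z\<^sup>T\<close> cancels the factor \<open>Z\<^sup>-\<^sup>T\<close> contributed by \<open>(L\<^sub>M A)\<^sup>T\<close>.
\<close>

lemma gsvd_adjoint:
  fixes A LM Minv N Z Zi U S :: "real Matrix.mat"
  assumes A: "A \<in> carrier_mat m n" and LM: "LM \<in> carrier_mat m m"
    and Minv: "Minv = transpose_mat LM * LM"
    and Z: "Z \<in> carrier_mat n n" and Zi: "Zi \<in> carrier_mat n n" and ZiZ: "Zi * Z = 1\<^sub>m n"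
    and N: "N = Z * transpose_mat Z"
    and U: "U \<in> carrier_mat m m" and S: "S \<in> carrier_mat m n"
    and svd: "LM * A = U * S * Zi"
    and y: "y \<in> carrier_vec m"
  shows "(N * transpose_mat A * Minv) *\<^sub>v y =
    Z *\<^sub>v (transpose_mat S *\<^sub>v (transpose_mat U *\<^sub>v (LM *\<^sub>v y)))"
proof -
  define z where "z = LM *\<^sub>v y"
  have z: "z \<in> carrier_vec m" unfolding z_def using LM y by simp
  have tA: "transpose_mat A \<in> carrier_mat n m" and tLM: "transpose_mat LM \<in> carrier_mat m m"
    and tZ: "transpose_mat Z \<in> carrier_mat n n" and tZi: "transpose_mat Zi \<in> carrier_mat n n"
    and tS: "transpose_mat S \<in> carrier_mat n m" and tU: "transpose_mat U \<in> carrier_mat m m"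
    using A LM Z Zi S U by auto
  have Nc: "N \<in> carrier_mat n n" unfolding N using Z tZ by simp
  have Mc: "Minv \<in> carrier_mat m m" unfolding Minv using LM tLM by simp
  let ?q = "transpose_mat S *\<^sub>v (transpose_mat U *\<^sub>v z)"
  have q: "?q \<in> carrier_vec n" using tS tU z by simp
  have 1: "Minv *\<^sub>v y = transpose_mat LM *\<^sub>v z"
    unfolding Minv z_def using tLM LM y by (rule assoc_mult_mat_vec)
  have "transpose_mat A *\<^sub>v (transpose_mat LM *\<^sub>v z) = (transpose_mat A * transpose_mat LM) *\<^sub>v z"
    using assoc_mult_mat_vec[OF tA tLM z] by simp
  also have "transpose_mat A * transpose_mat LM = transpose_mat (LM * A)"
    using transpose_mult[OF LM A] by simp
  also have "\<dots> = transpose_mat Zi * (transpose_mat S * transpose_mat U)"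
    unfolding svd using transpose_mult[OF mult_carrier_mat[OF U S] Zi] transpose_mult[OF U S] by simp
  also have "\<dots> *\<^sub>v z = transpose_mat Zi *\<^sub>v ?q"
    using assoc_mult_mat_vec[OF tZi mult_carrier_mat[OF tS tU] z] assoc_mult_mat_vec[OF tS tU z] by simp
  finally have 2: "transpose_mat A *\<^sub>v (transpose_mat LM *\<^sub>v z) = transpose_mat Zi *\<^sub>v ?q" .
  have "N *\<^sub>v (transpose_mat Zi *\<^sub>v ?q) = Z *\<^sub>v (transpose_mat Z *\<^sub>v (transpose_mat Zi *\<^sub>v ?q))"
    unfolding N using Z tZ tZi q by (intro assoc_mult_mat_vec) auto
  also have "transpose_mat Z *\<^sub>v (transpose_mat Zi *\<^sub>v ?q) = transpose_mat (Zi * Z) *\<^sub>v ?q"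
    using assoc_mult_mat_vec[OF tZ tZi q] transpose_mult[OF Zi Z] by simp
  also have "\<dots> = ?q" unfolding ZiZ using q by simp
  finally have 3: "N *\<^sub>v (transpose_mat Zi *\<^sub>v ?q) = Z *\<^sub>v ?q" .
  have "(N * transpose_mat A * Minv) *\<^sub>v y = N *\<^sub>v (transpose_mat A *\<^sub>v (Minv *\<^sub>v y))"
    using assoc_mult_mat_vec[OF mult_carrier_mat[OF Nc tA] Mc y]
      assoc_mult_mat_vec[OF Nc tA, of "Minv *\<^sub>v y"] Mc y by simp
  then show ?thesis unfolding 1 2 3 unfolding z_def .
qed

lemma gsvd_normal_operator:
  fixes A LM Minv N Z Zi U S :: "real Matrix.mat"
  assumes A: "A \<in> carrier_mat m n" and LM: "LM \<in> carrier_mat m m"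
    and Minv: "Minv = transpose_mat LM * LM"
    and Z: "Z \<in> carrier_mat n n" and Zi: "Zi \<in> carrier_mat n n" and ZiZ: "Zi * Z = 1\<^sub>m n"
    and N: "N = Z * transpose_mat Z"
    and U: "U \<in> carrier_mat m m" and UU: "transpose_mat U * U = 1\<^sub>m m"
    and S: "S \<in> carrier_mat m n"
    and svd: "LM * A = U * S * Zi"
    and c: "c \<in> carrier_vec n"
  shows "(N * transpose_mat A * Minv) *\<^sub>v (A *\<^sub>v (Z *\<^sub>v c)) =
    Z *\<^sub>v (transpose_mat S *\<^sub>v (S *\<^sub>v c))"
proof -
  have Zc: "Z *\<^sub>v c \<in> carrier_vec n" and Sc: "S *\<^sub>v c \<in> carrier_vec m" using Z S c by auto
  have "LM *\<^sub>v (A *\<^sub>v (Z *\<^sub>v c)) = (U * S * Zi) *\<^sub>v (Z *\<^sub>v c)"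
    using assoc_mult_mat_vec[OF LM A Zc] svd by simp
  also have "\<dots> = (U * S) *\<^sub>v (Zi *\<^sub>v (Z *\<^sub>v c))"
    using mult_carrier_mat[OF U S] Zi Zc by (rule assoc_mult_mat_vec)
  also have "Zi *\<^sub>v (Z *\<^sub>v c) = c" unfolding assoc_mult_mat_vec[OF Zi Z c, symmetric] ZiZ using c by simp
  also have "(U * S) *\<^sub>v c = U *\<^sub>v (S *\<^sub>v c)" using U S c by (rule assoc_mult_mat_vec)
  finally have "transpose_mat U *\<^sub>v (LM *\<^sub>v (A *\<^sub>v (Z *\<^sub>v c))) = (transpose_mat U * U) *\<^sub>v (S *\<^sub>v c)"
    using assoc_mult_mat_vec[OF _ U Sc, of "transpose_mat U" m] U by simp
  then have "transpose_mat U *\<^sub>v (LM *\<^sub>v (A *\<^sub>v (Z *\<^sub>v c))) = S *\<^sub>v c" using UU Sc by simp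
  moreover have "A *\<^sub>v (Z *\<^sub>v c) \<in> carrier_vec m" using A Zc by simp
  ultimately show ?thesis
    using gsvd_adjoint[OF A LM Minv Z Zi ZiZ N U S svd, of "A *\<^sub>v (Z *\<^sub>v c)"] by simp
qed

text \<open>
  A one-sided inverse of a square matrix is two-sided, so \<open>Z\<^sup>T B Z = 1\<close> gives \<open>Z Z\<^sup>T B = 1\<close>.
\<close>

lemma gram_eq_of_orthonormal:
  fixes N B Z :: "real Matrix.mat"
  assumes N: "N \<in> carrier_mat n n" and B: "B \<in> carrier_mat n n" and BN: "B * N = 1\<^sub>m n"
    and Z: "Z \<in> carrier_mat n n" and on: "transpose_mat Z * B * Z = 1\<^sub>m n"
  shows "N = Z * transpose_mat Z"
proof -
  have tZ: "transpose_mat Z \<in> carrier_mat n n" using Z by simp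
  have "Z * (transpose_mat Z * B) = 1\<^sub>m n"
    using mult_carrier_mat[OF tZ B] Z on by (rule mat_mult_left_right_inverse)
  then have "(Z * transpose_mat Z) * B = 1\<^sub>m n" using assoc_mult_mat[OF Z tZ B] by simp
  moreover have "(Z * transpose_mat Z) * B * N = (Z * transpose_mat Z) * (B * N)"
    using mult_carrier_mat[OF Z tZ] B N by (rule assoc_mult_mat)
  ultimately show ?thesis using BN N Z tZ by simp
qed

lemma col_space_first_cols:
  fixes Z :: "real Matrix.mat"
  assumes Z: "Z \<in> carrier_mat n n" and k: "k \<le> n"
  shows "vec_space.col_space n (first_cols k Z) = {Z *\<^sub>v (y @\<^sub>v 0\<^sub>v (n - k)) |y. y \<in> carrier_vec k}"
proof -
  interpret vec_space "TYPE(real)" n .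
  have F: "first_cols k Z \<in> carrier_mat n k"
    unfolding first_cols_def using Z k mat_of_cols_carrier(1)[of n "take k (Matrix.cols Z)"] by simp
  have "first_cols k Z *\<^sub>v y = Z *\<^sub>v (y @\<^sub>v 0\<^sub>v (n - k))" if y: "y \<in> carrier_vec k" for y
  proof (rule eq_vecI)
    fix a assume "a < dim_vec (Z *\<^sub>v (y @\<^sub>v 0\<^sub>v (n - k)))"
    then have a: "a < n" using Z by simp
    have "(Z *\<^sub>v (y @\<^sub>v 0\<^sub>v (n - k))) $ a = (\<Sum>j<n. Z $$ (a, j) * (y @\<^sub>v 0\<^sub>v (n - k)) $ j)"
      using a Z y k by (simp add: scalar_prod_def atLeast0LessThan)
    also have "\<dots> = (\<Sum>j<k. Z $$ (a, j) * (y @\<^sub>v 0\<^sub>v (n - k)) $ j)"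
      using y k by (intro sum.mono_neutral_right) auto
    also have "\<dots> = (\<Sum>j<k. first_cols k Z $$ (a, j) * y $ j)"
      using a Z y k by (intro sum.cong) (auto simp: first_cols_def mat_of_cols_def)
    also have "\<dots> = (first_cols k Z *\<^sub>v y) $ a"
      using a F y by (simp add: scalar_prod_def atLeast0LessThan)
    finally show "(first_cols k Z *\<^sub>v y) $ a = (Z *\<^sub>v (y @\<^sub>v 0\<^sub>v (n - k))) $ a" ..
  qed (use Z F in simp)
  moreover have "first_cols k Z *\<^sub>v y \<in> carrier_vec n" if "y \<in> carrier_vec k" for y
    using F that by simp
  ultimately show ?thesis unfolding col_space_eq[OF F] using F by auto
qed

section \<open>The bidiagonalization\<close>

text \<open>
  Applying \<open>P = A\<^sup>*\<close> to the recurrence for the \<open>u i\<close> and eliminating each \<open>P u i\<close> by the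
  recurrence for the \<open>v i\<close> leaves the Lanczos recurrence for \<open>A\<^sup>* A\<close>.  The scalars are kept on
  the left-hand side, undivided, because nothing is known yet about their being nonzero.
\<close>

lemma gen_gkb_three_term:
  assumes A: "A \<in> carrier_mat m n"
    and P: "P = N * transpose_mat A * mat_inv M" "P \<in> carrier_mat n m"
    and gkb: "gen_gkb k A b M N u v \<alpha> \<beta>"
  shows "1 \<le> k \<Longrightarrow> (\<alpha> 1 * \<beta> 1) \<cdot>\<^sub>v v 1 = P *\<^sub>v b"
    and "1 \<le> i \<Longrightarrow> i < k \<Longrightarrow> (\<alpha> (Suc i) * \<beta> (Suc i)) \<cdot>\<^sub>v v (Suc i) =
      P *\<^sub>v (A *\<^sub>v v i) - ((\<alpha> i)\<^sup>2 + (\<beta> (Suc i))\<^sup>2) \<cdot>\<^sub>v v i - (\<alpha> i * \<beta> i) \<cdot>\<^sub>v v (i - 1)"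
proof -
  have uv: "u j \<in> carrier_vec m" "v j \<in> carrier_vec n" if "j \<in> {1..k}" for j
    using gkb that A unfolding gen_gkb_def by auto
  have v0: "v 0 = 0\<^sub>v n" using gkb A unfolding gen_gkb_def by auto
  have v_pred: "v (j - 1) \<in> carrier_vec n" if "j \<in> {1..k}" for j
  proof (cases "j = 1")
    case False
    then have "j - 1 \<in> {1..k}" using that by auto
    then show ?thesis by (rule uv(2))
  qed (simp add: v0)
  have init: "\<beta> 1 \<cdot>\<^sub>v u 1 = b"
    and vrec: "\<And>j. j \<in> {1..k} \<Longrightarrow> \<alpha> j \<cdot>\<^sub>v v j = P *\<^sub>v u j - \<beta> j \<cdot>\<^sub>v v (j - 1)"
    and urec: "\<And>j. j \<in> {1..<k} \<Longrightarrow> \<beta> (j + 1) \<cdot>\<^sub>v u (j + 1) = A *\<^sub>v v j - \<alpha> j \<cdot>\<^sub>v u j"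
    using gkb unfolding gen_gkb_def P(1) by auto
  have Pu: "(P *\<^sub>v u j) $ a = \<alpha> j * v j $ a + \<beta> j * v (j - 1) $ a" if "j \<in> {1..k}" "a < n" for j a
    using arg_cong[OF vrec[OF that(1)], of "\<lambda>x. x $ a"] uv[OF that(1)] v_pred[OF that(1)] P(2) that(2)
    by simp
  {
    assume k: "1 \<le> k"
    have "P *\<^sub>v b = \<beta> 1 \<cdot>\<^sub>v (P *\<^sub>v u 1)"
      unfolding init[symmetric] using k uv by (intro mult_mat_vec[OF P(2)]) auto
    then show "(\<alpha> 1 * \<beta> 1) \<cdot>\<^sub>v v 1 = P *\<^sub>v b"
      using k uv[of 1] P(2) Pu[of 1] v0 by (intro eq_vecI) auto
  next
    assume i: "1 \<le> i" "i < k"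
    then have i_in: "i \<in> {1..k}" "Suc i \<in> {1..k}" "i \<in> {1..<k}" by auto
    note c = uv[OF i_in(1)] uv[OF i_in(2)] v_pred[OF i_in(1)]
    have Av: "A *\<^sub>v v i \<in> carrier_vec m" using A c by simp
    have "\<beta> (Suc i) \<cdot>\<^sub>v (P *\<^sub>v u (Suc i)) = P *\<^sub>v (\<beta> (Suc i) \<cdot>\<^sub>v u (Suc i))"
      using mult_mat_vec[OF P(2) c(3)] by simp
    also have "\<dots> = P *\<^sub>v (A *\<^sub>v v i - \<alpha> i \<cdot>\<^sub>v u i)" using urec[OF i_in(3)] by simp
    also have "\<dots> = P *\<^sub>v (A *\<^sub>v v i) - \<alpha> i \<cdot>\<^sub>v (P *\<^sub>v u i)"
      using mult_minus_distrib_mat_vec[OF P(2) Av, of "\<alpha> i \<cdot>\<^sub>v u i"] mult_mat_vec[OF P(2) c(1)] c(1)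
      by simp
    finally have eq: "\<beta> (Suc i) \<cdot>\<^sub>v (P *\<^sub>v u (Suc i)) = P *\<^sub>v (A *\<^sub>v v i) - \<alpha> i \<cdot>\<^sub>v (P *\<^sub>v u i)" .
    show "(\<alpha> (Suc i) * \<beta> (Suc i)) \<cdot>\<^sub>v v (Suc i) =
      P *\<^sub>v (A *\<^sub>v v i) - ((\<alpha> i)\<^sup>2 + (\<beta> (Suc i))\<^sup>2) \<cdot>\<^sub>v v i - (\<alpha> i * \<beta> i) \<cdot>\<^sub>v v (i - 1)"
    proof (rule eq_vecI)
      fix a assume "a < dim_vec (P *\<^sub>v (A *\<^sub>v v i) - ((\<alpha> i)\<^sup>2 + (\<beta> (Suc i))\<^sup>2) \<cdot>\<^sub>v v i - (\<alpha> i * \<beta> i) \<cdot>\<^sub>v v (i - 1))"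
      then have a: "a < n" using c by simp
      have "\<beta> (Suc i) * (P *\<^sub>v u (Suc i)) $ a = (P *\<^sub>v (A *\<^sub>v v i)) $ a - \<alpha> i * (P *\<^sub>v u i) $ a"
        using arg_cong[OF eq, of "\<lambda>x. x $ a"] a P(2) by simp
      then have "(P *\<^sub>v (A *\<^sub>v v i)) $ a = \<beta> (Suc i) * (\<alpha> (Suc i) * v (Suc i) $ a + \<beta> (Suc i) * v i $ a)
          + \<alpha> i * (\<alpha> i * v i $ a + \<beta> i * v (i - 1) $ a)"
        using Pu[OF i_in(1) a] Pu[OF i_in(2) a] by simp
      moreover have "((\<alpha> (Suc i) * \<beta> (Suc i)) \<cdot>\<^sub>v v (Suc i)) $ a = \<alpha> (Suc i) * \<beta> (Suc i) * v (Suc i) $ a"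
        using a c by simp
      moreover have "(P *\<^sub>v (A *\<^sub>v v i) - ((\<alpha> i)\<^sup>2 + (\<beta> (Suc i))\<^sup>2) \<cdot>\<^sub>v v i - (\<alpha> i * \<beta> i) \<cdot>\<^sub>v v (i - 1)) $ a
          = (P *\<^sub>v (A *\<^sub>v v i)) $ a - ((\<alpha> i)\<^sup>2 + (\<beta> (Suc i))\<^sup>2) * v i $ a - \<alpha> i * \<beta> i * v (i - 1) $ a"
        using a c P(2) by simp
      ultimately show "((\<alpha> (Suc i) * \<beta> (Suc i)) \<cdot>\<^sub>v v (Suc i)) $ a =
          (P *\<^sub>v (A *\<^sub>v v i) - ((\<alpha> i)\<^sup>2 + (\<beta> (Suc i))\<^sup>2) \<cdot>\<^sub>v v i - (\<alpha> i * \<beta> i) \<cdot>\<^sub>v v (i - 1)) $ a"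
        by (simp add: algebra_simps power2_eq_square)
    qed (use c in simp)
  }
qed

section \<open>The distance between the solution subspace and the leading generalized singular vectors\<close>

theorem theorem4p1:
  fixes m n r k :: nat
    and A M N LM LN UA UL DA Z D1 D2 H1 H2 \<Delta> :: "real Matrix.mat"
    and b :: "real Matrix.vec"
    and \<sigma> \<alpha> \<beta> :: "nat \<Rightarrow> real"
    and u v :: "nat \<Rightarrow> real Matrix.vec"
  assumes "A \<in> carrier_mat m n" and "vec_space.rank m A = r"
    and "b \<in> carrier_vec m"
    and "sym_pos_def m M" and "sym_pos_def n N"
    and "cholesky_factor m (mat_inv M) LM" and "cholesky_factor n (mat_inv N) LN"
    and "normalized_gsvd m n r (LM * A) LN N UA UL \<sigma> DA Z"
    and "\<forall>i \<in> {1..r}. scalar_prod (Matrix.col UA (i - 1)) (LM *\<^sub>v b) \<noteq> 0"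
    and "inj_on \<sigma> {1..r}"
    and "1 \<le> k" and "k \<le> r"
    and "D1 \<in> carrier_mat k k" and "D2 \<in> carrier_mat (r - k) (r - k)"
    and "vec_diag (DA *\<^sub>v (transpose_mat (first_cols r UA) *\<^sub>v (LM *\<^sub>v b))) =
           four_block_mat D1 (0\<^sub>m k (r - k)) (0\<^sub>m (r - k) k) D2"
    and "H1 \<in> carrier_mat k k" and "H2 \<in> carrier_mat (r - k) k"
    and "Matrix.mat r k (\<lambda>(i, j). \<sigma> (Suc i) ^ (2 * j)) = H1 @\<^sub>r H2"
    and "\<Delta> = D2 * H2 * mat_inv H1 * mat_inv D1"
    and "gen_gkb k A b M N u v \<alpha> \<beta>"
  shows "subspace_dist (mat_inv N)
           (vec_space.col_space n (mat_of_cols n (map v [1..<Suc k])))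
           (vec_space.col_space n (first_cols k Z)) =
         spectral_norm \<Delta> / sqrt (1 + (spectral_norm \<Delta>)\<^sup>2)"
proof -
  note A = assms(1) and b = assms(3) and k = assms(11,12)
  define w where "w j = \<sigma> (Suc j) * scalar_prod (Matrix.col UA j) (LM *\<^sub>v b)" for j
  define s where "s j = (\<sigma> (Suc j))\<^sup>2" for j
  define S where "S = rect_diag m n r (\<lambda>j. \<sigma> (Suc j))"
  define P where "P = N * transpose_mat A * mat_inv M"
  let ?K = "krylov_coords n r w s"
  have N: "N \<in> carrier_mat n n" using assms(5) by (simp add: sym_pos_def_def)
  have N_inj: "x = 0\<^sub>v n" if "x \<in> carrier_vec n" "N *\<^sub>v x = 0\<^sub>v n" for x
    using assms(5) that by (force simp: sym_pos_def_def)
  note N_inv = mat_inv_of_injective[OF N N_inj]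
  have LM: "LM \<in> carrier_mat m m" and Minv: "mat_inv M = transpose_mat LM * LM"
    using assms(6) by (auto simp: cholesky_factor_def)
  have Minv_c: "mat_inv M \<in> carrier_mat m m" unfolding Minv using LM by simp
  note g = assms(8)[unfolded normalized_gsvd_def]
  have rm: "r \<le> m" and rn: "r \<le> n" and Z: "Z \<in> carrier_mat n n"
    and on: "transpose_mat Z * mat_inv N * Z = 1\<^sub>m n"
    and U: "UA \<in> carrier_mat m m" and UU: "transpose_mat UA * UA = 1\<^sub>m m"
    and DA: "DA = mat_diag r (\<lambda>i. \<sigma> (Suc i))"
    and \<sigma>_pos: "\<And>i. i \<in> {1..r} \<Longrightarrow> 0 < \<sigma> i"
    using g[unfolded orthonormal_mat_def] by (elim conjE; (assumption | simp only: Ball_def))+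
  have S: "S \<in> carrier_mat m n" by (simp add: S_def)
  have svd: "LM * A = UA * S * mat_inv Z"
    unfolding S_def four_block_rect_diag[OF rm rn, symmetric] DA[symmetric]
    using g by (elim conjE)
  have Zinj: "c = 0\<^sub>v n" if "c \<in> carrier_vec n" "Z *\<^sub>v c = 0\<^sub>v n" for c
    using left_inverse_injective[OF _ Z on that] Z N_inv(1) by simp
  note Z_inv = mat_inv_of_injective[OF Z Zinj]
  have gram: "N = Z * transpose_mat Z"
    by (rule gram_eq_of_orthonormal[OF N N_inv(1,3) Z on])
  have Pc: "P \<in> carrier_mat n m" unfolding P_def using N A Minv_c by simp
  have LMb: "LM *\<^sub>v b \<in> carrier_vec m" using LM b by simp
  have w0: "w j \<noteq> 0" if "j < r" for j
  proof -
    have "Suc j \<in> {1..r}" using that by auto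
    then show ?thesis using \<sigma>_pos[of "Suc j"] assms(9)[rule_format, of "Suc j"] by (simp add: w_def)
  qed
  have s_inj: "inj_on s {..<r}"
  proof (rule inj_onI)
    fix i j assume ij: "i \<in> {..<r}" "j \<in> {..<r}" "s i = s j"
    then have "0 < \<sigma> (Suc i)" "0 < \<sigma> (Suc j)" using \<sigma>_pos by auto
    then have "\<sigma> (Suc i) = \<sigma> (Suc j)" using ij(3) by (simp add: s_def)
    then show "i = j" using inj_onD[OF assms(10), of "Suc i" "Suc j"] ij by auto
  qed
  have start: "P *\<^sub>v b = Z *\<^sub>v ?K 1"
  proof -
    have Ub: "transpose_mat UA *\<^sub>v (LM *\<^sub>v b) \<in> carrier_vec m" using U LMb by simp
    have eq: "transpose_mat S *\<^sub>v (transpose_mat UA *\<^sub>v (LM *\<^sub>v b)) = ?K 1"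
      unfolding S_def transpose_rect_diag rect_diag_mult_vec[OF rm Ub] krylov_coords_def
      using U rm by (intro eq_vecI) (auto simp: w_def)
    show ?thesis
      using gsvd_adjoint[OF A LM Minv Z Z_inv(1,3) gram U S svd b] unfolding eq P_def .
  qed
  have shift: "P *\<^sub>v (A *\<^sub>v (Z *\<^sub>v ?K p)) = Z *\<^sub>v ?K ([:0, 1:] * p)" for p
  proof -
    have eq: "transpose_mat S *\<^sub>v (S *\<^sub>v ?K p) = ?K ([:0, 1:] * p)"
      unfolding S_def transpose_rect_diag rect_diag_mult_vec[OF rn krylov_coords_carrier]
      using rm rn by (subst rect_diag_mult_vec)
        (auto simp: krylov_coords_def s_def power2_eq_square intro!: eq_vecI)
    show ?thesis
      using gsvd_normal_operator[OF A LM Minv Z Z_inv(1,3) gram U UU S svd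
          krylov_coords_carrier[of n r w s p]]
      unfolding eq P_def .
  qed
  note three_term = gen_gkb_three_term[OF A P_def Pc assms(20)]
  have krylov: "\<exists>q. v (Suc i) = Z *\<^sub>v ?K q \<and> q \<noteq> 0 \<and> degree q = i" if "i < k" for i
  proof (rule three_term_polynomials[OF Z Zinj rn k(2) s_inj w0 _ _ _ shift three_term(2) that])
    show "v j \<in> carrier_vec n" if "j \<in> {1..k}" for j
      using assms(20) that A unfolding gen_gkb_def by auto
    show "v 0 = 0\<^sub>v n" using assms(20) A unfolding gen_gkb_def by auto
    show "(\<alpha> 1 * \<beta> 1) \<cdot>\<^sub>v v 1 = Z *\<^sub>v ?K 1" using three_term(1)[OF k(1)] start by simp
  qed
  obtain q where q: "\<And>i. i < k \<Longrightarrow> v (Suc i) = Z *\<^sub>v ?K (q i) \<and> q i \<noteq> 0 \<and> degree (q i) = i"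
    using krylov by metis
  have D: "mat_diag r w = four_block_mat D1 (0\<^sub>m k (r - k)) (0\<^sub>m (r - k) k) D2"
  proof -
    have F: "first_cols r UA \<in> carrier_mat m r"
      unfolding first_cols_def using U rm mat_of_cols_carrier(1)[of m "take r (Matrix.cols UA)"] by simp
    have col: "Matrix.col (first_cols r UA) j = Matrix.col UA j" if "j < r" for j
      unfolding first_cols_def using U rm that by (subst col_mat_of_cols) auto
    have y: "transpose_mat (first_cols r UA) *\<^sub>v (LM *\<^sub>v b) \<in> carrier_vec r" using F LMb by simp
    have DA': "DA = rect_diag r r r (\<lambda>j. \<sigma> (Suc j))"
      unfolding DA by (intro eq_matI) (auto simp: rect_diag_def mat_diag_def)
    have "DA *\<^sub>v (transpose_mat (first_cols r UA) *\<^sub>v (LM *\<^sub>v b)) = Matrix.vec r w"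
      unfolding DA' rect_diag_mult_vec[OF order_refl y]
      using F by (intro eq_vecI) (auto simp: w_def col)
    then have "vec_diag (DA *\<^sub>v (transpose_mat (first_cols r UA) *\<^sub>v (LM *\<^sub>v b))) = mat_diag r w"
      unfolding vec_diag_def by (simp, intro eq_matI) (auto simp: mat_diag_def)
    then show ?thesis using assms(15) by simp
  qed
  have H: "Matrix.mat r k (\<lambda>(i, j). s i ^ j) = H1 @\<^sub>r H2"
    unfolding assms(18)[symmetric] by (simp add: s_def power_mult)
  note graph = krylov_graph[where w = w and s = s, OF rn k(2) s_inj w0 assms(13,14) D assms(16,17) H assms(19)]
  let ?T = "\<Delta> @\<^sub>r 0\<^sub>m (n - r) k"
  have n: "k + (n - k) = n" using k(2) rn by simp
  have T: "?T \<in> carrier_mat (n - k) k"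
    using carrier_append_rows[OF graph(1), of "0\<^sub>m (n - r) k" "n - r"] k(2) rn by simp
  have "vec_space.col_space n (mat_of_cols n (map v [1..<Suc k])) =
      (\<lambda>c. Z *\<^sub>v c) ` {?K p |p. \<forall>i \<ge> k. poly.coeff p i = 0}"
    using col_space_krylov[where v = v and q = q, OF Z q] by (auto simp del: upt_Suc)
  also have "\<dots> = (\<lambda>c. Z *\<^sub>v c) ` {x @\<^sub>v (?T *\<^sub>v x) |x. x \<in> carrier_vec k}"
    using graph(2) by (rule arg_cong)
  finally have "vec_space.col_space n (mat_of_cols n (map v [1..<Suc k])) =
      {Z *\<^sub>v (x @\<^sub>v (?T *\<^sub>v x)) |x. x \<in> carrier_vec k}"
    by (auto simp del: upt_Suc)
  moreover have "vec_space.col_space n (first_cols k Z) =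
      {Z *\<^sub>v (y @\<^sub>v 0\<^sub>v (n - k)) |y. y \<in> carrier_vec k}"
    using k(2) rn by (intro col_space_first_cols[OF Z]) simp
  ultimately show ?thesis
    using subspace_dist_graph[of "mat_inv N" k "n - k" Z ?T, unfolded n, OF N_inv(1) Z on T k(1)]
    by (simp add: spectral_norm_append_zero_rows[OF graph(1)])
qed

end
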